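(* Let $K \subset \mathbb{R}^d$ be a compact cusp-free $d$-dimensional set (equal to the closure of its interior), and let $q$ be a point in the interior of $\operatorname{conv}(K)$. Then there exists a projective transformation $\phi \colon \mathbb{R}\mathrm{P}^d \to \mathbb{R}\mathrm{P}^d$, admissible with respect to $K$, such that the centroid of $\phi(K)$ is $\phi(q)$: \[ \gamma(\phi(K)) = \phi(q). \] For any other projective transformation $\psi$, admissible with respect to $K$, with $\gamma(\psi(K)) = \psi(q)$, the composition $\phi \circ \psi^{-1}$ is affine.
   Context: $\mathbb{R}^d$ is identified with the affine chart $\{(x_0 : x_1 : \cdots : x_d) \mid x_0 \neq 0\}$ of $\mathbb{R}\mathrm{P}^d$. A projective transformation $\phi$ of $\mathbb{R}\mathrm{P}^d$ is admissible for $K \subset \mathbb{R}^d$ if $\phi(\operatorname{conv}(K)) \subset \mathbb{R}^d$; it is affine if it restricts to a map $x \mapsto Ax+b$ of $\mathbb{R}^d$, $A \in \mathrm{GL}(d)$. The centroid of a compact set $K \subset \mathbb{R}^d$ of positive volume is $\gamma(K) = \frac{1}{\operatorname{vol}(K)} \int_K x\, dx$ (Lebesgue measure). A $d$-dimensional compact set $K \subset \mathbb{R}^d$ is cusp-free if for every $x \in K \cap \partial \operatorname{conv} K$ there is a (non-degenerate) $d$-simplex contained in $K$ with a vertex at $x$. *)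

theory Defs
  imports "HOL-Analysis.Analysis"
begin

definition homog_rel :: "real \<times> (real^'n) \<Rightarrow> real \<times> (real^'n) \<Rightarrow> bool" where
  "homog_rel v w \<longleftrightarrow> v \<noteq> 0 \<and> w \<noteq> 0 \<and> (\<exists>c. c \<noteq> 0 \<and> w = c *\<^sub>R v)"

lemma part_equivp_homog_rel: "part_equivp (homog_rel :: real \<times> (real^'n) \<Rightarrow> _)"
proof (rule part_equivpI)
  show "\<exists>v :: real \<times> (real^'n). homog_rel v v"
    by (rule exI[of _ "(1, 0)"]) (auto simp: homog_rel_def zero_prod_def intro!: exI[of _ 1])
  show "symp (homog_rel :: real \<times> (real^'n) \<Rightarrow> _)"
  proof (rule sympI)
    fix v w :: "real \<times> (real^'n)"
    assume "homog_rel v w"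
    then obtain c where c: "v \<noteq> 0" "w \<noteq> 0" "c \<noteq> 0" "w = c *\<^sub>R v"
      by (auto simp: homog_rel_def)
    then have "v = inverse c *\<^sub>R w" by simp
    with c show "homog_rel w v"
      unfolding homog_rel_def by (metis inverse_nonzero_iff_nonzero)
  qed
  show "transp (homog_rel :: real \<times> (real^'n) \<Rightarrow> _)"
  proof (rule transpI)
    fix u v w :: "real \<times> (real^'n)"
    assume "homog_rel u v" "homog_rel v w"
    then obtain a b where ab: "u \<noteq> 0" "w \<noteq> 0" "a \<noteq> 0" "v = a *\<^sub>R u" "b \<noteq> 0" "w = b *\<^sub>R v"
      by (auto simp: homog_rel_def)
    then have "w = (b * a) *\<^sub>R u" "b * a \<noteq> 0" "u \<noteq> 0" by auto
    with ab show "homog_rel u w"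
      unfolding homog_rel_def by blast
  qed
qed

text \<open>
  Real projective space of dimension \<open>d = CARD('n)\<close>: the nonzero vectors \<open>(x\<^sub>0, x)\<close> of
  \<open>\<real> \<times> \<real>\<^sup>d\<close> up to nonzero scalars. The quotient is partial, so \<open>proj_point 0\<close> is unspecified;
  \<open>proj_point (x\<^sub>0, x)\<close> is the point with homogeneous coordinates \<open>(x\<^sub>0 : x\<^sub>1 : \<dots> : x\<^sub>d)\<close>.
\<close>

quotient_type 'n proj_space = "real \<times> (real^'n::finite)" / partial: homog_rel
  morphisms homog_coords proj_point
  by (rule part_equivp_homog_rel)

lemma proj_point_eq_iff:
  "v \<noteq> 0 \<Longrightarrow> w \<noteq> 0 \<Longrightarrow> proj_point v = proj_point w \<longleftrightarrow> (\<exists>c. c \<noteq> 0 \<and> w = c *\<^sub>R v)"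
  using Quotient3_rel[OF Quotient3_proj_space, of v w]
  by (auto simp: homog_rel_def intro: exI[of _ "1::real"])

definition affine_chart :: "real^'n \<Rightarrow> 'n proj_space" where
  "affine_chart x = proj_point (1, x)"

lemma inj_affine_chart: "inj affine_chart"
  by (auto simp: inj_def affine_chart_def proj_point_eq_iff zero_prod_def)

lemma range_affine_chart:
  "range (affine_chart :: real^'n \<Rightarrow> _) = {proj_point (x0, x) | x0 x. x0 \<noteq> 0}"
proof (intro equalityI subsetI)
  fix p :: "'n proj_space"
  assume "p \<in> {proj_point (x0, x) | x0 x. x0 \<noteq> 0}"
  then obtain x0 x where "x0 \<noteq> 0" and p: "p = proj_point (x0, x)" by auto
  then have "p = affine_chart (inverse x0 *\<^sub>R x)"
    unfolding affine_chart_def p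
    by (subst proj_point_eq_iff) (auto simp: zero_prod_def intro!: exI[of _ "inverse x0"])
  then show "p \<in> range affine_chart" by simp
qed (auto simp: affine_chart_def intro: exI[of _ "1::real"])

definition projective_transformation :: "(('n::finite) proj_space \<Rightarrow> 'n proj_space) \<Rightarrow> bool" where
  "projective_transformation \<phi> \<longleftrightarrow>
     (\<exists>F :: real \<times> (real^'n) \<Rightarrow> real \<times> (real^'n).
        linear F \<and> bij F \<and> (\<forall>v. v \<noteq> 0 \<longrightarrow> \<phi> (proj_point v) = proj_point (F v)))"

definition admissible :: "(('n::finite) proj_space \<Rightarrow> 'n proj_space) \<Rightarrow> (real^'n) set \<Rightarrow> bool" where
  "admissible \<phi> K \<longleftrightarrow> \<phi> ` affine_chart ` (convex hull K) \<subseteq> range affine_chart"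

definition affine_transformation :: "(('n::finite) proj_space \<Rightarrow> 'n proj_space) \<Rightarrow> bool" where
  "affine_transformation \<phi> \<longleftrightarrow>
     projective_transformation \<phi> \<and>
     (\<exists>(A :: real^'n^'n) b. invertible A \<and> (\<forall>x. \<phi> (affine_chart x) = affine_chart (A *v x + b)))"

text \<open>
  The part of \<open>\<phi>(K)\<close> in the affine chart, as a subset of \<open>\<real>\<^sup>d\<close>; this is all of \<open>\<phi>(K)\<close>
  when \<open>\<phi>\<close> is admissible for \<open>K\<close>.
\<close>

definition proj_image :: "(('n::finite) proj_space \<Rightarrow> 'n proj_space) \<Rightarrow> (real^'n) set \<Rightarrow> (real^'n) set" where
  "proj_image \<phi> K = affine_chart -` \<phi> ` affine_chart ` K"

definition centroid :: "(real^'n) set \<Rightarrow> real^'n" where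
  "centroid K = (1 / measure lebesgue K) *\<^sub>R (LINT x:K|lebesgue. x)"

definition cusp_free :: "(real^'n) set \<Rightarrow> bool" where
  "cusp_free K \<longleftrightarrow>
     (\<forall>x \<in> K \<inter> frontier (convex hull K).
        \<exists>S. int CARD('n) simplex S \<and> S \<subseteq> K \<and> x extreme_point_of S)"

end

theory Submission
  imports Defs
begin

text \<open>
  Up to an affine map applied afterwards, a projective transformation that is admissible for \<open>K\<close>
  is determined by the linear form whose zero set it sends to infinity. This form has no zero on
  \<open>conv K\<close>, and scaled to be \<open>1\<close> at \<open>q\<close> it is \<open>s\<^sub>a(x) = 1 - a \<bullet> (x - q)\<close> with \<open>s\<^sub>a > 0\<close> on \<open>K\<close>. So the
  vectors \<open>a\<close> in the open convex set \<open>U = {a. \<forall>x\<in>K. 0 < s\<^sub>a(x)}\<close> parametrise the problem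
  (lemma \<open>projective_normal_form\<close>), each one represented by the map
  \<open>p\<^sub>a(x) = q + (x - q) / s\<^sub>a(x)\<close>, which fixes \<open>q\<close>.

  The map \<open>p\<^sub>a\<close> has Jacobian determinant \<open>s\<^sub>a\<^sup>-\<^sup>(\<^sup>d\<^sup>+\<^sup>1\<^sup>)\<close>. Hence \<open>p\<^sub>a(K)\<close> has volume
  \<open>F(a) = \<integral>\<^sub>K s\<^sub>a\<^sup>-\<^sup>(\<^sup>d\<^sup>+\<^sup>1\<^sup>)\<close>, and its centroid is \<open>q\<close> exactly when
  \<open>G(a) = \<integral>\<^sub>K s\<^sub>a\<^sup>-\<^sup>(\<^sup>d\<^sup>+\<^sup>2\<^sup>) (x - q)\<close> vanishes (lemma \<open>centering_iff_projected_moment_eq_0\<close>). But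
  \<open>(d + 1) G\<close> is the gradient of \<open>F\<close>, so the theorem says that the strictly convex function \<open>F\<close> has
  exactly one critical point in \<open>U\<close>.

  A critical point exists because \<open>F\<close> attains its minimum: \<open>U\<close> is bounded since \<open>q\<close> is interior
  to \<open>conv K\<close>, and \<open>F\<close> tends to infinity at every boundary point \<open>a\<close> of \<open>U\<close>. There \<open>s\<^sub>a\<close> vanishes
  at some point of \<open>K\<close> on the boundary of \<open>conv K\<close>, and by cusp-freeness \<open>K\<close> contains a
  simplex at that point, over which \<open>s\<^sub>a\<^sup>-\<^sup>(\<^sup>d\<^sup>+\<^sup>1\<^sup>)\<close> has infinite integral
  (lemma \<open>projected_volume_blowup\<close>). It is unique because the gradient of a strictly convex function is
  injective (lemma \<open>projected_moment_zero_unique\<close>). Two transformations with the same \<open>a\<close>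
  differ by an affine map (lemma \<open>affine_transformation_same_slack\<close>).
\<close>

section \<open>Change of variables for an arbitrary finite index type\<close>

text \<open>
  The change-of-variables theorem \<open>has_absolute_integral_change_of_variables_compact\<close> is about
  \<open>real^'m\<close> with a well-ordered finite index type \<open>'m\<close>. A copy of an arbitrary finite type, ordered by
  a chosen enumeration, makes it applicable to every index type: permuting coordinates
  preserves Lebesgue measure and determinants.
\<close>

typedef ('a::finite) enumerated = "UNIV :: 'a set" ..

definition enumeration_index :: "'a::finite enumerated \<Rightarrow> nat" where
  "enumeration_index x = (SOME f :: 'a \<Rightarrow> nat. inj f) (Rep_enumerated x)"

lemma inj_enumeration_index: "inj (enumeration_index :: 'a::finite enumerated \<Rightarrow> nat)"
proof -
  have "\<exists>f :: 'a \<Rightarrow> nat. inj f"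
    using finite_imp_inj_to_nat_seg[OF finite[of "UNIV :: 'a set"]] by blast
  then have "inj (SOME f :: 'a \<Rightarrow> nat. inj f)"
    by (rule someI_ex[where P = inj])
  then show ?thesis
    by (intro injI) (simp add: enumeration_index_def inj_eq Rep_enumerated_inject)
qed

lemma bij_Rep_enumerated: "bij (Rep_enumerated :: 'a::finite enumerated \<Rightarrow> 'a)"
  by (rule o_bij[where g = Abs_enumerated])
    (simp_all add: fun_eq_iff Abs_enumerated_inverse Rep_enumerated_inverse)

instance enumerated :: (finite) finite
proof
  show "finite (UNIV :: 'a enumerated set)"
    using bij_betw_finite[OF bij_Rep_enumerated[where 'a = 'a]] by simp
qed

instantiation enumerated :: (finite) wellorder
begin

definition less_eq_enumerated :: "'a enumerated \<Rightarrow> 'a enumerated \<Rightarrow> bool" where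
  "x \<le> y \<longleftrightarrow> enumeration_index x \<le> enumeration_index y"

definition less_enumerated :: "'a enumerated \<Rightarrow> 'a enumerated \<Rightarrow> bool" where
  "x < y \<longleftrightarrow> enumeration_index x < enumeration_index y"

instance
proof
  fix P :: "'a enumerated \<Rightarrow> bool" and a
  assume step: "\<And>x. (\<And>y. y < x \<Longrightarrow> P y) \<Longrightarrow> P x"
  show "P a"
  proof (induction a rule: measure_induct_rule[where f = enumeration_index])
    case (less x)
    then show ?case
      using step[of x] by (simp add: less_enumerated_def)
  qed
qed (simp_all add: less_eq_enumerated_def less_enumerated_def less_le_not_le linear
    inj_eq[OF inj_enumeration_index, symmetric])

end

definition relabel :: "real^'n::finite \<Rightarrow> real^'n enumerated" where
  "relabel x = (\<chi> i. x $ Rep_enumerated i)"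

definition unlabel :: "real^'n enumerated \<Rightarrow> real^'n::finite" where
  "unlabel y = (\<chi> j. y $ Abs_enumerated j)"

lemma unlabel_relabel [simp]: "unlabel (relabel x) = x"
  by (simp add: unlabel_def relabel_def Abs_enumerated_inverse)

lemma linear_relabel: "linear relabel"
  by (rule linearI) (simp_all add: relabel_def vec_eq_iff)

lemma linear_unlabel: "linear unlabel"
  by (rule linearI) (simp_all add: unlabel_def vec_eq_iff)

lemmas bounded_linear_relabel = linear_linear[THEN iffD2, OF linear_relabel]
lemmas bounded_linear_unlabel = linear_linear[THEN iffD2, OF linear_unlabel]

lemma prod_inner_Basis_cart:
  fixes v :: "real^'m"
  shows "(\<Prod>b\<in>Basis. v \<bullet> b) = (\<Prod>i\<in>UNIV. v $ i)"
proof -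
  have "bij_betw (\<lambda>i. axis i (1::real)) (UNIV :: 'm set) Basis"
    by (auto simp: bij_betw_def Basis_vec_def inj_def axis_eq_axis)
  from prod.reindex_bij_betw[OF this, of "\<lambda>b. v \<bullet> b"] show ?thesis
    by (simp add: inner_axis)
qed

lemma lborel_relabel: "distr lborel borel (relabel :: real^'n::finite \<Rightarrow> _) = lborel"
proof (rule lborel_eqI[symmetric])
  fix l u :: "real^'n enumerated"
  assume le: "\<And>b. b \<in> Basis \<Longrightarrow> l \<bullet> b \<le> u \<bullet> b"
  have le': "l $ i \<le> u $ i" for i
    using le[of "axis i 1"] by (simp add: inner_axis)
  have vimage: "relabel -` box l u = box (unlabel l) (unlabel u)"
  proof -
    have "(\<forall>i. l $ i < x $ Rep_enumerated i \<and> x $ Rep_enumerated i < u $ i)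
        \<longleftrightarrow> (\<forall>j. l $ Abs_enumerated j < x $ j \<and> x $ j < u $ Abs_enumerated j)" for x :: "real^'n"
      by (metis Abs_enumerated_inverse Rep_enumerated_inverse UNIV_I)
    then show ?thesis
      by (auto simp: mem_box_cart relabel_def unlabel_def)
  qed
  have [measurable]: "relabel \<in> borel_measurable (borel :: (real^'n) measure)"
    by (intro borel_measurable_continuous_onI linear_continuous_on bounded_linear_relabel)
  have "emeasure (distr lborel borel relabel) (box l u)
      = emeasure lborel (box (unlabel l) (unlabel u))"
    by (simp add: emeasure_distr vimage)
  also have "\<dots> = (\<Prod>b\<in>Basis. (unlabel u - unlabel l) \<bullet> b)"
  proof (rule emeasure_lborel_box)
    fix b :: "real^'n" assume "b \<in> Basis"
    then obtain i where "b = axis i 1" by (auto simp: Basis_vec_def)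
    then show "unlabel l \<bullet> b \<le> unlabel u \<bullet> b"
      using le'[of "Abs_enumerated i"] by (simp add: inner_axis unlabel_def)
  qed
  also have "(\<Prod>b\<in>Basis. (unlabel u - unlabel l) \<bullet> b) = (\<Prod>j\<in>UNIV. (u - l) $ Abs_enumerated j)"
    unfolding prod_inner_Basis_cart by (simp add: unlabel_def)
  also have "\<dots> = (\<Prod>i\<in>UNIV. (u - l) $ i)"
    by (rule prod.reindex_bij_witness[where i = Rep_enumerated and j = Abs_enumerated])
      (auto simp: Rep_enumerated_inverse Abs_enumerated_inverse)
  also have "\<dots> = (\<Prod>b\<in>Basis. (u - l) \<bullet> b)"
    unfolding prod_inner_Basis_cart ..
  finally show "emeasure (distr lborel borel relabel) (box l u) = (\<Prod>b\<in>Basis. (u - l) \<bullet> b)" .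
qed simp

text \<open>
  Conjugation by \<open>r\<close> turns permutations of one index type into permutations of the other and
  preserves the sign, so the two Leibniz sums agree term by term.
\<close>

lemma det_reindex:
  fixes A :: "'a::comm_ring_1^'n::finite^'n" and r :: "'m::finite \<Rightarrow> 'n"
  assumes "bij r"
  shows "det (\<chi> i j. A $ r i $ r j) = det A"
proof -
  define s where "s = inv r"
  have sr: "s (r i) = i" "r (s j) = j" for i j
    using assms by (auto simp: s_def bij_def surj_f_inv_f)
  have bs: "bij s" unfolding s_def using assms by (rule bij_imp_bij_inv)
  have "det A = (\<Sum>p | p permutes (UNIV :: 'm set). of_int (sign p) * (\<Prod>i\<in>UNIV. A $ r i $ r (p i)))"
    unfolding det_def
  proof (rule sum.reindex_bij_witness[where i = "map_permutation UNIV r" and j = "map_permutation UNIV s"])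
    fix p :: "'n \<Rightarrow> 'n" assume p: "p \<in> {p. p permutes UNIV}"
    then have p': "p permutes UNIV" by simp
    show "map_permutation UNIV r (map_permutation UNIV s p) = p"
      by (rule map_permutation_compose_inv) (use bs p' sr in auto)
    show "map_permutation UNIV s p \<in> {p. p permutes UNIV}"
      using map_permutation_permutes[OF bs p'] by simp
    have sgn: "sign (map_permutation UNIV s p) = sign p"
      using evenperm_map_permutation[of s UNIV p] bs p' by (simp add: sign_def bij_def)
    have ap: "map_permutation UNIV s p i = s (p (r i))" for i
      using map_permutation_apply[of s UNIV "r i" p] bs by (simp add: sr bij_def)
    have "(\<Prod>i\<in>UNIV. A $ r i $ p (r i)) = (\<Prod>j\<in>UNIV. A $ j $ p j)"
      by (rule prod.reindex_bij_betw[OF assms])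
    then show "of_int (sign (map_permutation UNIV s p)) * (\<Prod>i\<in>UNIV. A $ r i $ r (map_permutation UNIV s p i))
        = of_int (sign p) * (\<Prod>i\<in>UNIV. A $ i $ p i)"
      by (simp add: sgn ap sr)
  next
    fix p :: "'m \<Rightarrow> 'm" assume p: "p \<in> {p. p permutes UNIV}"
    then have p': "p permutes UNIV" by simp
    show "map_permutation UNIV s (map_permutation UNIV r p) = p"
      by (rule map_permutation_compose_inv) (use assms p' sr in auto)
    show "map_permutation UNIV r p \<in> {p. p permutes UNIV}"
      using map_permutation_permutes[OF assms p'] by simp
  qed
  then show ?thesis by (simp add: det_def)
qed

lemma det_relabel:
  fixes L :: "real^'n::finite \<Rightarrow> real^'n"
  shows "det (matrix (relabel \<circ> L \<circ> unlabel)) = det (matrix L)"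
proof -
  have "unlabel (axis j 1) = axis (Rep_enumerated j) 1" for j :: "'n enumerated"
    by (auto simp: unlabel_def axis_def vec_eq_iff Abs_enumerated_inverse Rep_enumerated_inverse)
  then have "matrix (relabel \<circ> L \<circ> unlabel)
      = (\<chi> i j. matrix L $ Rep_enumerated i $ Rep_enumerated j)"
    by (simp add: matrix_def relabel_def)
  then show ?thesis
    by (simp add: det_reindex bij_Rep_enumerated)
qed

lemma integral_lborel_eq_integral_compact:
  fixes f :: "'a::euclidean_space \<Rightarrow> 'b::euclidean_space"
  assumes "compact S" "continuous_on S f"
  shows "(LINT x|lborel. indicator S x *\<^sub>R f x) = integral S f"
  using set_borel_integral_eq_integral(2)[of S f] borel_integrable_compact[OF assms]
  by (simp add: set_integrable_def set_lebesgue_integral_def)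

lemma integral_relabel_image:
  fixes f :: "real^('n::finite) enumerated \<Rightarrow> 'b::euclidean_space"
  assumes S: "compact (S :: (real^'n) set)" and f: "continuous_on (relabel ` S) f"
  shows "integral (relabel ` S) f = integral S (f \<circ> relabel)"
proof -
  have cont: "continuous_on X relabel" for X :: "(real^'n) set"
    by (intro linear_continuous_on bounded_linear_relabel)
  have S': "compact (relabel ` S)"
    using S cont by (rule compact_continuous_image[rotated])
  have mem: "relabel x \<in> relabel ` S \<longleftrightarrow> x \<in> S" for x
    by (metis image_iff unlabel_relabel)
  have "integral (relabel ` S) f = (LINT y|lborel. indicator (relabel ` S) y *\<^sub>R f y)"
    using S' f by (simp add: integral_lborel_eq_integral_compact)
  also have "\<dots> = (LINT y|distr lborel borel relabel. indicator (relabel ` S) y *\<^sub>R f y)"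
    by (simp add: lborel_relabel)
  also have "\<dots> = (LINT x|lborel. indicator (relabel ` S) (relabel x) *\<^sub>R f (relabel x))"
  proof (rule integral_distr)
    show "(relabel :: real^'n \<Rightarrow> _) \<in> borel_measurable lborel"
      using borel_measurable_continuous_onI[OF cont[of UNIV]] by simp
    show "(\<lambda>y. indicator (relabel ` S) y *\<^sub>R f y) \<in> borel_measurable borel"
      using borel_measurable_integrable[OF borel_integrable_compact[OF S' f]] by simp
  qed
  also have "\<dots> = (LINT x|lborel. indicator S x *\<^sub>R (f \<circ> relabel) x)"
    by (simp add: indicator_def mem)
  also have "\<dots> = integral S (f \<circ> relabel)"
    using S f cont by (intro integral_lborel_eq_integral_compact continuous_on_compose) auto
  finally show ?thesis .
qed

text \<open>
  The well-ordered case, applied to \<open>relabel \<circ> g \<circ> unlabel\<close> on \<open>relabel ` S\<close>, gives the identity; all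
  integrands are continuous on compact sets, so integrability is automatic.
\<close>

lemma integral_change_of_variables_compact:
  fixes g :: "real^'n::finite \<Rightarrow> real^'n" and f :: "real^'n \<Rightarrow> real^'k::finite"
  assumes S: "compact S"
    and g': "\<And>x. x \<in> S \<Longrightarrow> (g has_derivative g' x) (at x within S)"
    and inj: "inj_on g S"
    and f: "continuous_on (g ` S) f"
    and det: "continuous_on S (\<lambda>x. det (matrix (g' x)))"
  shows "integral (g ` S) f = integral S (\<lambda>x. \<bar>det (matrix (g' x))\<bar> *\<^sub>R f (g x))"
proof -
  define h where "h = relabel \<circ> g \<circ> unlabel"
  define h' where "h' y = relabel \<circ> g' (unlabel y) \<circ> unlabel" for y
  define T where "T = relabel ` S"
  have cg: "continuous_on S g"
    using g' by (meson continuous_on_eq_continuous_within has_derivative_continuous)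
  have crl: "continuous_on X relabel" for X :: "(real^'n) set"
    by (intro linear_continuous_on bounded_linear_relabel)
  have cul: "continuous_on X unlabel" for X :: "(real^'n enumerated) set"
    by (intro linear_continuous_on bounded_linear_unlabel)
  have T: "compact T" unfolding T_def using S crl by (rule compact_continuous_image[rotated])
  have uT: "unlabel ` T = S" by (auto simp: T_def image_image)
  have hT: "h ` T = relabel ` g ` S" by (auto simp: h_def T_def image_image)
  have ghS: "compact (g ` S)" using S cg by (rule compact_continuous_image[rotated])
  have h': "(h has_derivative h' y) (at y within T)" if y: "y \<in> T" for y
  proof -
    have "(unlabel has_derivative unlabel) (at y within T)"
      by (rule bounded_linear.has_derivative[OF bounded_linear_unlabel has_derivative_ident])
    then have "(g \<circ> unlabel has_derivative g' (unlabel y) \<circ> unlabel) (at y within T)"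
      using y uT g'[of "unlabel y"] by (intro diff_chain_within) auto
    from bounded_linear.has_derivative[OF bounded_linear_relabel this]
    show ?thesis by (simp add: h_def h'_def o_def)
  qed
  have injh: "inj_on h T"
    using inj by (auto simp: inj_on_def h_def T_def dest!: arg_cong[where f = unlabel])
  have fu: "continuous_on (h ` T) (f \<circ> unlabel)"
    by (intro continuous_on_compose cul) (use f in \<open>simp add: hT image_image\<close>)
  have hTc: "compact (h ` T)" unfolding hT using ghS crl by (rule compact_continuous_image[rotated])
  have "(\<lambda>y. (f \<circ> unlabel) y) absolutely_integrable_on (h ` T)"
    using borel_integrable_compact[OF hTc fu]
    by (simp add: absolutely_integrable_on_def integrable_on_lborel set_integrable_def integrable_completion)
  then have eq: "integral (h ` T) (f \<circ> unlabel)
      = integral T (\<lambda>y. \<bar>det (matrix (h' y))\<bar> *\<^sub>R (f \<circ> unlabel) (h y))"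
    using has_absolute_integral_change_of_variables_compact[OF T h' injh, of "f \<circ> unlabel"] by metis
  have "integral (h ` T) (f \<circ> unlabel) = integral (g ` S) f"
    unfolding hT
    using integral_relabel_image[OF ghS, of "f \<circ> unlabel"] fu by (simp add: hT o_def)
  moreover have "integral T (\<lambda>y. \<bar>det (matrix (h' y))\<bar> *\<^sub>R (f \<circ> unlabel) (h y))
      = integral S (\<lambda>x. \<bar>det (matrix (g' x))\<bar> *\<^sub>R f (g x))"
  proof -
    define F where "F = (\<lambda>y. \<bar>det (matrix (g' (unlabel y)))\<bar> *\<^sub>R f (g (unlabel y)))"
    have "continuous_on S (\<lambda>x. \<bar>det (matrix (g' x))\<bar> *\<^sub>R f (g x))"
      using cg det continuous_on_compose2[OF f cg] by (auto intro!: continuous_intros)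
    then have "continuous_on (relabel ` S) F"
      unfolding F_def by (rule continuous_on_compose2[OF _ cul]) (auto simp: image_image)
    then have "integral (relabel ` S) F = integral S (F \<circ> relabel)"
      by (rule integral_relabel_image[OF S])
    then show ?thesis
      unfolding T_def h'_def det_relabel by (simp add: h_def F_def o_def)
  qed
  ultimately show ?thesis using eq by simp
qed

section \<open>Integrals of continuous functions over compact sets\<close>

lemma integrable_on_compact_continuous:
  fixes f :: "'a::euclidean_space \<Rightarrow> 'b::euclidean_space"
  assumes "compact S" "continuous_on S f"
  shows "f integrable_on S"
  using set_borel_integral_eq_integral(1)[of S f] borel_integrable_compact[OF assms]
  by (simp add: set_integrable_def)

text \<open>
  By compactness of \<open>K\<close>, the functions \<open>f b\<close> converge to \<open>f a\<close> uniformly on \<open>K\<close> as \<open>b\<close> tends to \<open>a\<close>.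
\<close>

lemma continuous_on_integral_compact_parametric:
  fixes f :: "'c::metric_space \<Rightarrow> 'a::euclidean_space \<Rightarrow> 'b::euclidean_space"
  assumes K: "compact K" and f: "continuous_on (U \<times> K) (\<lambda>(a, x). f a x)"
  shows "continuous_on U (\<lambda>a. integral K (f a))"
  unfolding continuous_on_iff
proof (intro ballI allI impI)
  fix a and e :: real
  assume a: "a \<in> U" and e: "0 < e"
  have fK: "f b integrable_on K" if "b \<in> U" for b
  proof (rule integrable_on_compact_continuous[OF K])
    show "continuous_on K (f b)"
      using continuous_on_compose2[OF f continuous_on_Pair[OF continuous_on_const continuous_on_id], of b K] that
      by (auto simp: image_subset_iff)
  qed
  define m where "m = measure lebesgue K"
  have m: "0 \<le> m" "K \<in> lmeasurable"
    using K by (auto simp: m_def lmeasurable_compact)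
  define d where "d = e / (2 * (m + 1))"
  have d: "0 < d" using e m by (simp add: d_def)
  obtain X where X: "a \<in> X" "open X"
      "\<forall>b\<in>X \<inter> U. \<forall>x\<in>K. dist ((\<lambda>(a, x). f a x) (b, x)) ((\<lambda>(a, x). f a x) (a, x)) \<le> d"
    using continuous_on_prod_compactE[OF f K a d] by blast
  obtain r where r: "0 < r" "ball a r \<subseteq> X" using X by (meson openE)
  show "\<exists>d>0. \<forall>b\<in>U. dist b a < d \<longrightarrow> dist (integral K (f b)) (integral K (f a)) < e"
  proof (intro exI[of _ r] conjI ballI impI)
    fix b assume b: "b \<in> U" "dist b a < r"
    then have near: "norm (f b x - f a x) \<le> d" if "x \<in> K" for x
      using X r that by (auto simp: dist_norm dist_commute subset_iff)
    have "norm (integral K (\<lambda>x. f b x - f a x)) \<le> integral K (\<lambda>x. d)"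
      using near fK[OF a] fK[OF b(1)] m
      by (intro integral_norm_bound_integral integrable_diff) (auto intro: integrable_on_const)
    also have "\<dots> = d * m"
      using m by (simp add: lmeasure_integral m_def integral_mult_right[symmetric])
    also have "\<dots> < e"
      using e m by (simp add: d_def field_simps) (smt (verit) mult_nonneg_nonneg)
    finally show "dist (integral K (f b)) (integral K (f a)) < e"
      using fK[OF a] fK[OF b(1)] by (simp add: dist_norm integral_diff)
  qed (use r in auto)
qed

section \<open>The volume of the projected set as a convex function\<close>

text \<open>
  The affine function \<open>s\<^sub>a\<close>, normalised to be \<open>1\<close> at \<open>q\<close>; its zero set is the hyperplane that is sent
  to infinity.
\<close>

definition slack :: "'a::euclidean_space \<Rightarrow> 'a \<Rightarrow> 'a \<Rightarrow> real" where
  "slack q a x = 1 - a \<bullet> (x - q)"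

text \<open>
  For compact \<open>K\<close> this is the interior of the polar body of \<open>K - q\<close>.
\<close>

definition slack_domain :: "'a::euclidean_space set \<Rightarrow> 'a \<Rightarrow> 'a set" where
  "slack_domain K q = {a. \<forall>x\<in>K. 0 < slack q a x}"

text \<open>
  The volume \<open>F(a)\<close> of the image of \<open>K\<close> under \<open>x \<mapsto> q + (x - q) / s\<^sub>a(x)\<close>, for \<open>a\<close> in the slack
  domain, written as an integral over \<open>K\<close> itself.
\<close>

definition projected_volume :: "'a::euclidean_space set \<Rightarrow> 'a \<Rightarrow> 'a \<Rightarrow> real" where
  "projected_volume K q a = integral K (\<lambda>x. 1 / slack q a x ^ (DIM('a) + 1))"

text \<open>
  The first moment \<open>G(a)\<close> of the same image about \<open>q\<close>. The exponent is one higher than for the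
  volume because the displacement from \<open>q\<close> is itself divided by the slack; this
  makes \<open>G\<close> a multiple of the gradient of \<open>F\<close>.
\<close>

definition projected_moment :: "'a::euclidean_space set \<Rightarrow> 'a \<Rightarrow> 'a \<Rightarrow> 'a" where
  "projected_moment K q a = integral K (\<lambda>x. (1 / slack q a x ^ (DIM('a) + 2)) *\<^sub>R (x - q))"

lemma slack_domainD: "a \<in> slack_domain K q \<Longrightarrow> x \<in> K \<Longrightarrow> 0 < slack q a x"
  by (simp add: slack_domain_def)

lemma zero_in_slack_domain: "0 \<in> slack_domain K q"
  by (simp add: slack_domain_def slack_def)

lemma continuous_on_slack [continuous_intros]:
  assumes "continuous_on X f" "continuous_on X g"
  shows "continuous_on X (\<lambda>z. slack q (f z) (g z))"
  unfolding slack_def by (intro continuous_intros assms)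

lemma slack_diff: "slack q a x - slack q b x = (b - a) \<bullet> (x - q)"
  by (simp add: slack_def inner_diff_left)

lemma integrands_continuous:
  shows "continuous_on (slack_domain K q \<times> K) (\<lambda>(a, x). 1 / slack q a x ^ n)"
    and "continuous_on (slack_domain K q \<times> K) (\<lambda>(a, x). (1 / slack q a x ^ n) *\<^sub>R (x - q))"
  unfolding case_prod_beta
  by (intro continuous_intros; fastforce dest: slack_domainD)+

lemma integrands_integrable:
  assumes "compact K" "a \<in> slack_domain K q"
  shows "(\<lambda>x. 1 / slack q a x ^ n) integrable_on K"
    and "(\<lambda>x. (1 / slack q a x ^ n) *\<^sub>R (x - q)) integrable_on K"
  using assms
  by (intro integrable_on_compact_continuous continuous_intros; force dest: slack_domainD)+

lemma continuous_on_projected_volume: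
  assumes "compact K"
  shows "continuous_on (slack_domain K q) (projected_volume K q)"
  unfolding projected_volume_def[abs_def]
  by (intro continuous_on_integral_compact_parametric assms integrands_continuous)

lemma continuous_on_projected_moment:
  assumes "compact K"
  shows "continuous_on (slack_domain K q) (projected_moment K q)"
  unfolding projected_moment_def[abs_def]
  by (intro continuous_on_integral_compact_parametric assms integrands_continuous)

lemma compact_norm_diff_bound:
  fixes K :: "'a::euclidean_space set"
  assumes "compact K"
  obtains B where "0 < B" "\<And>x. x \<in> K \<Longrightarrow> norm (x - q) \<le> B"
proof -
  have "bounded ((\<lambda>x. x - q) ` K)"
    by (intro compact_imp_bounded compact_continuous_image continuous_intros assms)
  then show ?thesis
    using that by (auto simp: bounded_pos)
qed

lemma open_slack_domain:
  fixes K :: "'a::euclidean_space set"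
  assumes "compact K"
  shows "open (slack_domain K q)"
proof (cases "K = {}")
  case False
  obtain B where B: "0 < B" "\<And>x. x \<in> K \<Longrightarrow> norm (x - q) \<le> B"
    using compact_norm_diff_bound[OF assms] by metis
  show ?thesis
    unfolding open_contains_ball
  proof
    fix a assume a: "a \<in> slack_domain K q"
    obtain x0 where x0: "x0 \<in> K" "\<And>x. x \<in> K \<Longrightarrow> slack q a x0 \<le> slack q a x"
      using continuous_attains_inf[OF assms False continuous_on_slack[OF continuous_on_const continuous_on_id]]
      by blast
    have pos: "0 < slack q a x0" using a x0(1) by (rule slack_domainD)
    show "\<exists>e>0. ball a e \<subseteq> slack_domain K q"
    proof (intro exI[of _ "slack q a x0 / B"] conjI subsetI)
      fix b assume b: "b \<in> ball a (slack q a x0 / B)"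
      show "b \<in> slack_domain K q"
        unfolding slack_domain_def
      proof (intro CollectI ballI)
        fix x assume x: "x \<in> K"
        have "(b - a) \<bullet> (x - q) \<le> norm (b - a) * norm (x - q)" by (rule norm_cauchy_schwarz)
        also have "\<dots> \<le> norm (b - a) * B" using B(2)[OF x] by (simp add: mult_left_mono)
        also have "\<dots> < slack q a x0"
          using b B(1) by (simp add: dist_norm norm_minus_commute field_simps)
        finally show "0 < slack q b x" using x0(2)[OF x] slack_diff[of q a x b] by linarith
      qed
    qed (use pos B in simp)
  qed
qed (simp add: slack_domain_def)

lemma slack_pos_convex_hull:
  assumes "a \<in> slack_domain K q" "x \<in> convex hull K"
  shows "0 < slack q a x"
proof -
  have "{x. 0 < slack q a x} = {x. a \<bullet> x < 1 + a \<bullet> q}"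
    by (auto simp: slack_def inner_diff_right)
  then have "convex {x. 0 < slack q a x}" by (simp add: convex_halfspace_lt)
  moreover have "K \<subseteq> {x. 0 < slack q a x}" using assms(1) by (auto simp: slack_domain_def)
  ultimately show ?thesis using assms(2) hull_minimal[of K _ convex] by blast
qed

lemma slack_nonneg_convex_hull:
  assumes "\<And>x. x \<in> K \<Longrightarrow> 0 \<le> slack q a x" "x \<in> convex hull K"
  shows "0 \<le> slack q a x"
proof -
  have "{x. 0 \<le> slack q a x} = {x. a \<bullet> x \<le> 1 + a \<bullet> q}"
    by (auto simp: slack_def inner_diff_right)
  then have "convex {x. 0 \<le> slack q a x}" by (simp add: convex_halfspace_le)
  moreover have "K \<subseteq> {x. 0 \<le> slack q a x}" using assms(1) by auto
  ultimately show ?thesis using assms(2) hull_minimal[of K _ convex] by blast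
qed

text \<open>
  If \<open>conv K\<close> contains the ball of radius \<open>r\<close> around \<open>q\<close>, positivity of the slack at the point of that
  ball in direction \<open>a\<close> says \<open>r * norm a < 1\<close>.
\<close>

lemma bounded_slack_domain:
  assumes "q \<in> interior (convex hull K)"
  shows "bounded (slack_domain K q)"
proof -
  obtain r where r: "0 < r" "cball q r \<subseteq> convex hull K"
    using assms by (auto simp: mem_interior_cball)
  have "norm a \<le> 1 / r" if a: "a \<in> slack_domain K q" for a
  proof (cases "a = 0")
    case False
    have "q + (r / norm a) *\<^sub>R a \<in> convex hull K"
      using r False by (intro subsetD[OF r(2)]) (simp add: dist_norm)
    then have "0 < slack q a (q + (r / norm a) *\<^sub>R a)"
      using a by (rule slack_pos_convex_hull[rotated])
    then have "r * norm a < 1"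
      using False by (simp add: slack_def dot_square_norm power2_eq_square)
    then show ?thesis using r by (simp add: field_simps)
  qed (use r in simp)
  then show ?thesis by (auto simp: bounded_iff)
qed

text \<open>
  The tangent inequality of the convex function \<open>t \<mapsto> 1 / t ^ n\<close> at \<open>s\<close>. With \<open>r = s / t\<close> it reads
  \<open>1 + n (1 - 1 / r) \<le> r ^ n\<close>, which is Bernoulli's inequality weakened by \<open>1 - 1 / r \<le> r - 1\<close>.
\<close>

lemma inverse_power_tangent:
  fixes s t :: real
  assumes "0 < s" "0 < t"
  shows "1 / s ^ n + real n * (s - t) / s ^ (n + 1) \<le> 1 / t ^ n"
proof -
  have "1 + real n * (1 - t / s) \<le> 1 + real n * (s / t - 1)"
  proof -
    have "(s / t - 1) - (1 - t / s) = (s - t)\<^sup>2 / (s * t)"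
      using assms by (simp add: field_simps power2_eq_square)
    also have "\<dots> \<ge> 0" using assms by simp
    finally show ?thesis by (simp add: mult_left_mono)
  qed
  also have "\<dots> \<le> (1 + (s / t - 1)) ^ n"
    using assms by (intro Bernoulli_inequality) simp
  also have "\<dots> = s ^ n / t ^ n" by (simp add: power_divide)
  finally have "(1 + real n * (1 - t / s)) / s ^ n \<le> (s ^ n / t ^ n) / s ^ n"
    using assms by (intro divide_right_mono) auto
  then show ?thesis using assms by (simp add: field_simps)
qed

text \<open>
  The pointwise tangent inequality, integrated. It expresses both the convexity of \<open>F\<close> and that
  \<open>(d + 1) G\<close> is its gradient, without differentiating under the integral sign.
\<close>

lemma projected_volume_tangent:
  fixes K :: "'a::euclidean_space set"
  assumes K: "compact K" and a: "a \<in> slack_domain K q" and b: "b \<in> slack_domain K q"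
  shows "projected_volume K q a + real (DIM('a) + 1) * ((b - a) \<bullet> projected_moment K q a)
    \<le> projected_volume K q b"
proof -
  let ?n = "DIM('a) + 1"
  let ?m = "\<lambda>x. (1 / slack q a x ^ (DIM('a) + 2)) *\<^sub>R (x - q)"
  have m: "?m integrable_on K"
    by (rule integrands_integrable[OF K a])
  have m': "(\<lambda>x. real ?n * ((b - a) \<bullet> ?m x)) integrable_on K"
    using integrable_linear[OF m bounded_linear_inner_right[of "b - a"]]
    by (intro integrable_on_mult_right) (simp add: o_def)
  have "(b - a) \<bullet> projected_moment K q a = integral K (\<lambda>x. (b - a) \<bullet> ?m x)"
    unfolding projected_moment_def
    using integral_linear[OF m bounded_linear_inner_right[of "b - a"]] by (simp add: o_def)
  then have "projected_volume K q a + real ?n * ((b - a) \<bullet> projected_moment K q a)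
      = integral K (\<lambda>x. 1 / slack q a x ^ ?n + real ?n * ((b - a) \<bullet> ?m x))"
    unfolding projected_volume_def
    using integral_add[OF integrands_integrable(1)[OF K a, of ?n] m']
    by (simp only: integral_mult_right)
  also have "\<dots> \<le> projected_volume K q b"
    unfolding projected_volume_def
  proof (rule integral_le)
    show "(\<lambda>x. 1 / slack q a x ^ ?n + real ?n * ((b - a) \<bullet> ?m x)) integrable_on K"
      by (intro integrable_add integrands_integrable(1)[OF K a] m')
    show "1 / slack q a x ^ ?n + real ?n * ((b - a) \<bullet> ?m x) \<le> 1 / slack q b x ^ ?n" if "x \<in> K" for x
      using inverse_power_tangent[of "slack q a x" "slack q b x" ?n]
        slack_domainD[OF a that] slack_domainD[OF b that]
      by (simp add: slack_diff)
  qed (rule integrands_integrable(1)[OF K b])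
  finally show ?thesis .
qed

text \<open>
  This replaces the divergence of \<open>\<integral>\<^sub>S s\<^sub>a\<^sup>-\<^sup>(\<^sup>d\<^sup>+\<^sup>1\<^sup>)\<close> at \<open>x0\<close> by a scaling argument that is uniform in \<open>b\<close>
  near \<open>a\<close>. The copy of \<open>S\<close> shrunk by the factor \<open>t\<close> towards \<open>x0\<close> has volume of order \<open>t ^ d\<close>, and on it
  the slack of every \<open>b\<close> within distance \<open>t\<close> of \<open>a\<close> is at most of order \<open>t\<close>. It therefore
  contributes at least a constant times \<open>t ^ d / t ^ (d + 1) = 1 / t\<close>.
\<close>

lemma projected_volume_blowup:
  fixes K :: "'a::euclidean_space set"
  assumes K: "compact K" and S: "S \<subseteq> K" "convex S" "compact S" "0 < measure lebesgue S"
    and x0: "x0 \<in> S" "slack q a x0 = 0"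
  shows "\<exists>e>0. \<forall>b\<in>slack_domain K q. dist b a < e \<longrightarrow> M < projected_volume K q b"
proof -
  let ?n = "DIM('a) + 1"
  obtain B where B: "0 < B" "\<And>x. x \<in> K \<Longrightarrow> norm (x - q) \<le> B"
    using compact_norm_diff_bound[OF K] by metis
  obtain x1 where x1: "x1 \<in> S" "\<And>y. y \<in> S \<Longrightarrow> slack q a y \<le> slack q a x1"
    using continuous_attains_sup[OF S(3) _ continuous_on_slack[OF continuous_on_const continuous_on_id]] x0(1)
    by blast
  define C where "C = slack q a x1 + B"
  have C: "0 < C" using x1(2)[OF x0(1)] x0(2) B(1) by (simp add: C_def)
  \<comment> \<open>The shrunk copy will contribute at least \<open>c / t\<close>, which decides how small \<open>t\<close> must be.\<close>
  define c where "c = measure lebesgue S / C ^ ?n"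
  have c: "0 < c" using S(4) C by (simp add: c_def)
  define t where "t = min 1 (c / (\<bar>M\<bar> + 1))"
  have t: "0 < t" "t \<le> 1" using c by (auto simp: t_def)
  have "t \<le> c / (\<bar>M\<bar> + 1)" by (simp add: t_def)
  then have "\<bar>M\<bar> + 1 \<le> c / t" using t by (simp add: field_simps)
  then have Mt: "M < c / t" by linarith
  define T where "T = (\<lambda>y. t *\<^sub>R y + (1 - t) *\<^sub>R x0) ` S"
  have TS: "T \<subseteq> S"
    using S(2) x0(1) t by (auto simp: T_def intro!: convexD)
  have cT: "compact T"
    unfolding T_def by (intro compact_continuous_image continuous_intros S)
  have mT: "measure lebesgue T = t ^ DIM('a) * measure lebesgue S"
    unfolding T_def using measure_lebesgue_affine[of t "(1 - t) *\<^sub>R x0" S] t by simp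
  show ?thesis
  proof (intro exI[of _ t] conjI ballI impI)
    fix b assume b: "b \<in> slack_domain K q" "dist b a < t"
    have up: "slack q b x \<le> C * t" if x: "x \<in> T" for x
    proof -
      obtain y where y: "y \<in> S" "x = t *\<^sub>R y + (1 - t) *\<^sub>R x0"
        using x by (auto simp: T_def)
      have "slack q a x = t * slack q a y + (1 - t) * slack q a x0"
        unfolding y(2) slack_def by (simp add: algebra_simps inner_diff_right inner_add_right)
      then have "slack q a x \<le> t * slack q a x1"
        using x0(2) x1(2)[OF y(1)] t by simp
      moreover have "(a - b) \<bullet> (x - q) \<le> t * B"
      proof -
        have "(a - b) \<bullet> (x - q) \<le> norm (a - b) * norm (x - q)" by (rule norm_cauchy_schwarz)
        also have "\<dots> \<le> t * B"
          using b(2) B(2)[of x] that TS S(1)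
          using t(1) by (intro mult_mono) (auto simp: dist_norm norm_minus_commute)
        finally show ?thesis .
      qed
      ultimately show ?thesis
        using slack_diff[of q b x a] by (simp add: C_def algebra_simps)
    qed
    have bT: "b \<in> slack_domain T q" using b(1) TS S(1) by (auto simp: slack_domain_def)
    have "c / t = measure lebesgue T * (1 / (C * t) ^ ?n)"
      using t C by (simp add: c_def mT field_simps)
    also have "\<dots> = integral T (\<lambda>x. 1 * (1 / (C * t) ^ ?n))"
      by (subst integral_mult_left) (simp add: lmeasure_integral lmeasurable_compact cT)
    also have "\<dots> \<le> integral T (\<lambda>x. 1 / slack q b x ^ ?n)"
    proof (rule integral_le)
      show "(\<lambda>x. 1 * (1 / (C * t) ^ ?n)) integrable_on T"
        by (intro integrable_on_compact_continuous[OF cT] continuous_intros)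
      show "(\<lambda>x. 1 / slack q b x ^ ?n) integrable_on T"
        by (rule integrands_integrable[OF cT bT])
      show "1 * (1 / (C * t) ^ ?n) \<le> 1 / slack q b x ^ ?n" if "x \<in> T" for x
        using up[OF that] slack_domainD[OF bT that] C t
        by (simp only: mult_1) (intro divide_left_mono power_mono mult_pos_pos zero_less_power; simp)
    qed
    also have "\<dots> \<le> projected_volume K q b"
      unfolding projected_volume_def
    proof (rule integral_subset_le)
      show "T \<subseteq> K" using TS S(1) by blast
      show "\<forall>x\<in>K. 0 \<le> 1 / slack q b x ^ ?n"
        by (simp add: slack_domainD[OF b(1)] less_imp_le)
    qed (intro integrands_integrable cT bT K b(1))+
    finally show "M < projected_volume K q b" using Mt by linarith
  qed (use t in simp)
qed

text \<open>
  The sublevel set of \<open>F\<close> at \<open>0\<close> is compact: it is bounded, and the blow-up hypothesis keeps its limit points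
  inside the slack domain. So \<open>F\<close> has a minimiser, and there the gradient vanishes.
\<close>

lemma exists_projected_moment_eq_0:
  fixes K :: "'a::euclidean_space set"
  assumes K: "compact K" and q: "q \<in> interior (convex hull K)"
    and blowup: "\<And>a M. a \<notin> slack_domain K q \<Longrightarrow> (\<And>x. x \<in> K \<Longrightarrow> 0 \<le> slack q a x) \<Longrightarrow>
      \<exists>e>0. \<forall>b\<in>slack_domain K q. dist b a < e \<longrightarrow> M < projected_volume K q b"
  shows "\<exists>a\<in>slack_domain K q. projected_moment K q a = 0"
proof -
  let ?U = "slack_domain K q" and ?F = "projected_volume K q" and ?G = "projected_moment K q"
  define L where "L = {a \<in> ?U. ?F a \<le> ?F 0}"
  have "closed L"
    unfolding closed_sequential_limits
  proof (intro allI impI, elim conjE)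
    fix s a assume s: "\<forall>n. s n \<in> L" and lim: "s \<longlonglongrightarrow> a"
    have nonneg: "0 \<le> slack q a x" if "x \<in> K" for x
    proof (rule LIMSEQ_le_const)
      show "(\<lambda>n. slack q (s n) x) \<longlonglongrightarrow> slack q a x"
        unfolding slack_def by (intro tendsto_intros lim)
      show "\<exists>N. \<forall>n\<ge>N. 0 \<le> slack q (s n) x"
        using s that by (auto simp: L_def intro!: less_imp_le slack_domainD)
    qed
    show "a \<in> L"
    proof (cases "a \<in> ?U")
      case True
      have "(\<lambda>n. ?F (s n)) \<longlonglongrightarrow> ?F a"
        using s by (intro continuous_on_tendsto_compose[OF continuous_on_projected_volume[OF K] lim True])
          (auto simp: L_def)
      then have "?F a \<le> ?F 0"
        by (rule LIMSEQ_le_const2) (use s in \<open>auto simp: L_def\<close>)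
      then show ?thesis using True by (simp add: L_def)
    next
      case False
      then obtain e where e: "0 < e" "\<forall>b\<in>?U. dist b a < e \<longrightarrow> ?F 0 < ?F b"
        using blowup[OF _ nonneg] by blast
      obtain n where "dist (s n) a < e"
        using lim e(1) by (auto simp: lim_sequentially)
      then have False using e(2) s by (force simp: L_def)
      then show ?thesis ..
    qed
  qed
  moreover have "bounded L"
    by (rule bounded_subset[OF bounded_slack_domain[OF q]]) (auto simp: L_def)
  ultimately have "compact L" by (simp add: compact_eq_bounded_closed)
  moreover have "0 \<in> L" by (simp add: L_def zero_in_slack_domain)
  moreover have "continuous_on L ?F"
    by (rule continuous_on_subset[OF continuous_on_projected_volume[OF K]]) (auto simp: L_def)
  ultimately obtain a where a: "a \<in> L" "\<And>b. b \<in> L \<Longrightarrow> ?F a \<le> ?F b"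
    using continuous_attains_inf[of L ?F] by blast
  have aU: "a \<in> ?U" using a(1) by (simp add: L_def)
  have min: "?F a \<le> ?F b" if "b \<in> ?U" for b
    using a that by (cases "b \<in> L") (force simp: L_def)+
  \<comment> \<open>At a point \<open>s n\<close> slightly further in the direction \<open>h\<close>, the tangent inequality against the
    minimiser gives \<open>0 \<le> h \<bullet> ?G (s n)\<close>. The limit is \<open>0 \<le> h \<bullet> ?G a\<close>, and the choice \<open>h = - ?G a\<close>
    then forces \<open>?G a = 0\<close>.\<close>
  define h where "h = - ?G a"
  define s where "s n = a + (1 / real (Suc n)) *\<^sub>R h" for n
  have lim: "s \<longlonglongrightarrow> a"
    unfolding s_def using tendsto_add[OF tendsto_const[of a] tendsto_scaleR[OF LIMSEQ_inverse_real_of_nat tendsto_const[of h]]]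
    by (simp add: inverse_eq_divide)
  have ev: "\<forall>\<^sub>F n in sequentially. s n \<in> ?U"
    using lim open_slack_domain[OF K] aU by (rule topological_tendstoD)
  have "(\<lambda>n. h \<bullet> ?G (s n)) \<longlonglongrightarrow> h \<bullet> ?G a"
    by (intro tendsto_intros continuous_on_tendsto_compose[OF continuous_on_projected_moment[OF K] lim aU ev])
  moreover have "\<forall>\<^sub>F n in sequentially. 0 \<le> h \<bullet> ?G (s n)"
    using ev
  proof eventually_elim
    case (elim n)
    have "?F (s n) + real (DIM('a) + 1) * ((a - s n) \<bullet> ?G (s n)) \<le> ?F (s n)"
      using projected_volume_tangent[OF K elim aU] min[OF elim] by linarith
    then have "(a - s n) \<bullet> ?G (s n) \<le> 0"
      by (simp add: mult_le_0_iff)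
    then show ?case by (simp add: s_def divide_le_0_iff zero_le_divide_iff)
  qed
  ultimately have "0 \<le> h \<bullet> ?G a"
    by (intro tendsto_lowerbound) auto
  then have "?G a = 0"
    using inner_gt_zero_iff[of "?G a"] unfolding h_def inner_minus_left by linarith
  then show ?thesis using aU by blast
qed

text \<open>
  Strict monotonicity of the derivative of \<open>t \<mapsto> 1 / t ^ n\<close>, in the product form that becomes the
  monotonicity of the gradient \<open>G\<close> after integration.
\<close>

lemma inverse_power_strict_antimono_product:
  fixes s t :: real
  assumes "0 < s" "0 < t"
  shows "0 \<le> (s - t) * (1 / t ^ Suc n - 1 / s ^ Suc n)"
    and "(s - t) * (1 / t ^ Suc n - 1 / s ^ Suc n) = 0 \<longleftrightarrow> s = t"
proof -
  have pos: "0 < (s - t) * (1 / t ^ Suc n - 1 / s ^ Suc n)" if "s \<noteq> t" "0 < s" "0 < t" for s t :: real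
  proof (cases "s < t")
    case True
    then have "s ^ Suc n < t ^ Suc n" using that by (intro power_strict_mono) auto
    then have "1 / t ^ Suc n < 1 / s ^ Suc n"
      using that by (intro divide_strict_left_mono) (auto intro: mult_pos_pos)
    then show ?thesis using True by (intro mult_neg_neg) auto
  next
    case False
    then have "t ^ Suc n < s ^ Suc n" using that by (intro power_strict_mono) auto
    then have "1 / s ^ Suc n < 1 / t ^ Suc n"
      using that by (intro divide_strict_left_mono) (auto intro: mult_pos_pos)
    then show ?thesis using False that by (intro mult_pos_pos) auto
  qed
  show "0 \<le> (s - t) * (1 / t ^ Suc n - 1 / s ^ Suc n)"
    using pos[of s t] assms by (cases "s = t") auto
  show "(s - t) * (1 / t ^ Suc n - 1 / s ^ Suc n) = 0 \<longleftrightarrow> s = t"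
    using pos[of s t] assms by (cases "s = t") auto
qed

text \<open>
  The number \<open>(b - a) \<bullet> (G b - G a)\<close> is the integral of a nonnegative continuous function that
  vanishes only where the two slacks agree. If it is \<open>0\<close>, the slacks agree on a box inside \<open>K\<close>, and
  an affine function that vanishes on a box is zero.
\<close>

lemma projected_moment_zero_unique:
  fixes K :: "'a::euclidean_space set"
  assumes K: "compact K" "interior K \<noteq> {}"
    and a: "a \<in> slack_domain K q" "projected_moment K q a = 0"
    and b: "b \<in> slack_domain K q" "projected_moment K q b = 0"
  shows "a = b"
proof -
  let ?n = "DIM('a) + 2"
  define f where "f x = (slack q a x - slack q b x) * (1 / slack q b x ^ ?n - 1 / slack q a x ^ ?n)" for x
  have f: "0 \<le> f x" "f x = 0 \<longleftrightarrow> slack q a x = slack q b x" if "x \<in> K" for x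
    using inverse_power_strict_antimono_product[of "slack q a x" "slack q b x" "DIM('a) + 1"]
      slack_domainD[OF a(1) that] slack_domainD[OF b(1) that] by (simp_all add: f_def)
  have cf: "continuous_on K f"
    unfolding f_def using slack_domainD[OF a(1)] slack_domainD[OF b(1)]
    by (intro continuous_intros; force)
  let ?m = "\<lambda>c x. (1 / slack q c x ^ ?n) *\<^sub>R (x - q)"
  have int: "?m a integrable_on K" "?m b integrable_on K"
    by (rule integrands_integrable(2)[OF K(1) a(1)] integrands_integrable(2)[OF K(1) b(1)])+
  have "f x = (b - a) \<bullet> (?m b x - ?m a x)" for x
  proof -
    have "?m b x - ?m a x = (1 / slack q b x ^ ?n - 1 / slack q a x ^ ?n) *\<^sub>R (x - q)"
      by (rule scaleR_left_diff_distrib[symmetric])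
    then show ?thesis
      by (simp only: f_def slack_diff inner_scaleR_right) (rule mult.commute)
  qed
  then have "f = (\<lambda>x. (b - a) \<bullet> (?m b x - ?m a x))" by (rule ext)
  then have "integral K f = (b - a) \<bullet> integral K (\<lambda>x. ?m b x - ?m a x)"
    using integral_linear[OF integrable_diff[OF int(2,1)] bounded_linear_inner_right[of "b - a"]]
    by (simp add: o_def)
  also have "\<dots> = 0"
    using a(2) b(2) integral_diff[OF int(2,1)] by (simp add: projected_moment_def)
  finally have intf: "integral K f = 0" .
  obtain y where "y \<in> interior K" using K(2) by blast
  then obtain u v where uv: "y \<in> box u v" "cbox u v \<subseteq> interior K"
    using open_contains_cbox[OF open_interior] by metis
  have subK: "cbox u v \<subseteq> K" using uv(2) interior_subset by blast
  have cfuv: "continuous_on (cbox u v) f" by (rule continuous_on_subset[OF cf subK])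
  have "integral (cbox u v) f \<le> integral K f"
    by (intro integral_subset_le subK integrable_continuous[OF cfuv] integrable_on_compact_continuous[OF K(1) cf])
      (use f(1) in blast)
  moreover have "0 \<le> integral (cbox u v) f"
    using f subK by (intro integral_nonneg integrable_continuous[OF cfuv]) auto
  ultimately have "(f has_integral 0) (cbox u v)"
    using integrable_integral[OF integrable_continuous[OF cfuv]] intf by simp
  then have f0: "f x = 0" if "x \<in> cbox u v" for x
  proof (rule has_integral_0_cbox_imp_0[OF cfuv, rotated])
    show "box u v \<noteq> {}" using uv(1) by auto
    show "0 \<le> f z" if "z \<in> box u v" for z
      using that subK box_subset_cbox[of u v] by (intro f(1)) auto
  qed (rule that)
  have orth: "(b - a) \<bullet> (x - q) = 0" if "x \<in> cbox u v" for x
    using f0[OF that] f(2)[of x] subsetD[OF subK that] slack_diff[of q a x b] by linarith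
  obtain e where e: "0 < e" "cball y e \<subseteq> cbox u v"
    using uv(1) open_contains_cball[THEN iffD1, OF open_box[of u v]] box_subset_cbox[of u v]
    by (meson subset_trans)
  \<comment> \<open>Compare \<open>y\<close> with a second point of the box in direction \<open>b - a\<close>; the \<open>1\<close> keeps the quotient
    meaningful before \<open>a\<close> and \<open>b\<close> are known to differ.\<close>
  define c where "c = e / (norm (b - a) + 1)"
  have c: "0 < c"
    unfolding c_def using e(1) by (intro divide_pos_pos add_nonneg_pos) auto
  have "c * (norm (b - a) + 1) = e"
    unfolding c_def by (intro nonzero_eq_divide_eq[THEN iffD1] refl) (smt (verit) norm_ge_zero)
  then have "c * norm (b - a) \<le> e"
    using c by (simp add: distrib_left)
  then have "y + c *\<^sub>R (b - a) \<in> cbox u v"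
    using c by (intro subsetD[OF e(2)]) (simp add: dist_norm)
  moreover have "y \<in> cbox u v" using uv(1) box_subset_cbox by blast
  ultimately have "(b - a) \<bullet> ((y + c *\<^sub>R (b - a) - q) - (y - q)) = 0"
    using orth by (simp only: inner_diff_right)
  then show ?thesis using c by simp
qed

section \<open>The centroid of a projected set\<close>

lemma det_id_plus_column:
  fixes w :: "real^'n"
  shows "det (\<chi> i j. (if i = j then 1 else 0) + (if j = k then w $ i else 0)) = 1 + w $ k"
proof -
  have "(\<chi> i j. if j = k then (mat 1 *v (axis k 1 + w)) $ i else mat 1 $ i $ j)
      = ((\<chi> i j. (if i = j then 1 else 0) + (if j = k then w $ i else 0)) :: real^'n^'n)"
    unfolding matrix_vector_mul_lid by (auto simp: vec_eq_iff mat_def axis_def)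
  moreover have "det ((\<chi> i j. if j = k then (mat 1 *v (axis k 1 + w)) $ i else mat 1 $ i $ j) :: real^'n^'n)
      = (axis k 1 + w) $ k * det (mat 1 :: real^'n^'n)"
    by (rule cramer_lemma)
  ultimately show ?thesis by simp
qed

text \<open>
  The matrix determinant lemma. Let \<open>M\<close> be the identity with row \<open>k\<close> replaced by \<open>v\<close>, where
  \<open>v $ k \<noteq> 0\<close>; then \<open>v\<close> is the row vector \<open>e\<^sub>k M\<close>, so conjugation by \<open>M\<close> turns \<open>I + u v\<close> into
  \<open>I + (M u) e\<^sub>k\<close>, which differs from the identity in one column only.
\<close>

lemma det_id_plus_rank_one:
  fixes u v :: "real^'n"
  shows "det (\<chi> i j. (if i = j then 1 else 0) + u $ i * v $ j) = 1 + v \<bullet> u"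
proof (cases "v = 0")
  case True
  have "(\<chi> i j. (if i = j then 1 else 0) + u $ i * v $ j) = (mat 1 :: real^'n^'n)"
    by (simp add: True mat_def)
  then show ?thesis using True by simp
next
  case False
  then obtain k where k: "v $ k \<noteq> 0" by (auto simp: vec_eq_iff)
  define A :: "real^'n^'n" where "A = (\<chi> i j. (if i = j then 1 else 0) + u $ i * v $ j)"
  define M :: "real^'n^'n" where "M = (\<chi> i j. if i = k then v $ j else if i = j then 1 else 0)"
  define w where "w = M *v u"
  define B :: "real^'n^'n" where
    "B = (\<chi> i j. (if i = j then 1 else 0) + (if j = k then w $ i else 0))"
  have detM: "det M = v $ k"
  proof -
    have "(\<Sum>i\<in>UNIV. v $ i *s row i (mat 1 :: real^'n^'n)) = v"
      by (simp add: vec_eq_iff row_def mat_def if_distrib[of "(*) _"] cong: if_cong)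
    then have "M = (\<chi> i. if i = k then (\<Sum>i\<in>UNIV. v $ i *s row i (mat 1 :: real^'n^'n)) else row i (mat 1))"
      by (simp add: vec_eq_iff M_def row_def mat_def)
    then show ?thesis using cramer_lemma_transpose[where k = k and x = v and A = "mat 1 :: real^'n^'n"] by simp
  qed
  have "M ** A = B ** M"
  proof -
    have "(M ** A) $ i $ j = M $ i $ j + w $ i * v $ j" for i j
    proof -
      have "(M ** A) $ i $ j = (\<Sum>l\<in>UNIV. (if l = j then M $ i $ l else 0) + M $ i $ l * u $ l * v $ j)"
        by (auto simp: matrix_matrix_mult_def A_def algebra_simps intro!: sum.cong)
      then show ?thesis
        by (simp add: sum.distrib w_def matrix_vector_mult_def sum_distrib_right)
    qed
    moreover have "(B ** M) $ i $ j = M $ i $ j + w $ i * v $ j" for i j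
    proof -
      have "(B ** M) $ i $ j = (\<Sum>l\<in>UNIV. (if l = i then M $ l $ j else 0) + (if l = k then w $ i * M $ l $ j else 0))"
        by (auto simp: matrix_matrix_mult_def B_def algebra_simps intro!: sum.cong)
      also have "\<dots> = M $ i $ j + w $ i * M $ k $ j"
        by (simp add: sum.distrib)
      finally show ?thesis by (simp add: M_def)
    qed
    ultimately show ?thesis by (simp add: vec_eq_iff)
  qed
  then have "det M * det A = det B * det M" by (metis det_mul)
  then have "det A = det B" using k detM by simp
  also have "\<dots> = 1 + w $ k" unfolding B_def by (rule det_id_plus_column)
  also have "w $ k = v \<bullet> u" by (simp add: w_def M_def matrix_vector_mult_def inner_vec_def)
  finally show ?thesis by (simp add: A_def)
qed

text \<open>
  The projective map that sends the zero set of \<open>slack q a\<close> to infinity, normalised to fix \<open>q\<close> with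
  derivative the identity at \<open>q\<close>.
\<close>

definition central_projection :: "'a::euclidean_space \<Rightarrow> 'a \<Rightarrow> 'a \<Rightarrow> 'a" where
  "central_projection q a x = q + (1 / slack q a x) *\<^sub>R (x - q)"

lemma central_projection_center [simp]: "central_projection q a q = q"
  by (simp add: central_projection_def)

lemma has_derivative_central_projection:
  assumes "slack q a x \<noteq> 0"
  shows "(central_projection q a has_derivative
    (\<lambda>h. (1 / slack q a x) *\<^sub>R (h + ((a \<bullet> h) / slack q a x) *\<^sub>R (x - q)))) (at x within S)"
  unfolding central_projection_def[abs_def] slack_def
  using assms[unfolded slack_def]
  by (auto intro!: derivative_eq_intros simp: fun_eq_iff algebra_simps power2_eq_square divide_inverse inner_simps)

text \<open>
  The derivative is \<open>1 / s\<close> times a rank-one perturbation of the identity whose determinant is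
  \<open>1 + a \<bullet> (x - q) / s = 1 / s\<close>; this produces the exponent \<open>d + 1\<close>.
\<close>

lemma det_central_projection_derivative:
  fixes q a x :: "real^'n"
  assumes s: "slack q a x \<noteq> 0"
  shows "det (matrix (\<lambda>h. (1 / slack q a x) *\<^sub>R (h + ((a \<bullet> h) / slack q a x) *\<^sub>R (x - q))))
    = 1 / slack q a x ^ (CARD('n) + 1)" (is "det (matrix ?D) = _")
proof -
  let ?s = "slack q a x"
  define R :: "real^'n^'n" where
    "R = (\<chi> i j. (if i = j then 1 else 0) + (x - q) $ i * ((1 / ?s) *\<^sub>R a) $ j)"
  have "matrix ?D = (1 / ?s) *\<^sub>R R"
    by (simp add: matrix_def R_def vec_eq_iff inner_axis) (auto simp: axis_def field_simps)
  also have "\<dots> = matrix ((*\<^sub>R) (1 / ?s)) ** R"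
    by (simp add: vec_eq_iff matrix_matrix_mult_def matrix_def axis_def if_distrib if_distribR cong: if_cong)
  finally have "det (matrix ?D) = (1 / ?s) ^ CARD('n) * det R"
    by (simp add: det_mul)
  also have "det R = 1 + ((1 / ?s) *\<^sub>R a) \<bullet> (x - q)"
    unfolding R_def by (rule det_id_plus_rank_one)
  also have "\<dots> = 1 / ?s"
  proof -
    have "a \<bullet> (x - q) = 1 - ?s" by (simp add: slack_def)
    then show ?thesis using s by (simp only: inner_scaleR_left) (simp add: field_simps)
  qed
  finally show ?thesis by (simp add: power_divide)
qed

text \<open>
  The slack of \<open>x\<close> can be read off from its image \<open>y\<close>, because \<open>1 + a \<bullet> (y - q) = 1 / slack q a x\<close>.
\<close>

lemma inj_on_central_projection: "inj_on (central_projection q a) {x. 0 < slack q a x}"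
proof
  fix x y assume x: "x \<in> {x. 0 < slack q a x}" and y: "y \<in> {x. 0 < slack q a x}"
    and eq: "central_projection q a x = central_projection q a y"
  have e: "(1 / slack q a x) *\<^sub>R (x - q) = (1 / slack q a y) *\<^sub>R (y - q)"
    using eq by (simp add: central_projection_def)
  have "1 + a \<bullet> ((1 / slack q a z) *\<^sub>R (z - q)) = 1 / slack q a z" if "0 < slack q a z" for z
  proof -
    have "a \<bullet> (z - q) = 1 - slack q a z" by (simp add: slack_def)
    then show ?thesis using that by (simp only: inner_scaleR_right) (simp add: field_simps)
  qed
  from this[of x] this[of y] have "1 / slack q a x = 1 / slack q a y"
    using x y e by simp
  then show "x = y" using e x by simp
qed

text \<open>
  The volume of the image is any one coordinate of the integral of the constant vector \<open>1\<close> over it, so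
  the vector-valued change of variables covers it.
\<close>

lemma lmeasure_compact_image:
  fixes g :: "real^'n \<Rightarrow> real^'n"
  assumes S: "compact S"
    and g': "\<And>x. x \<in> S \<Longrightarrow> (g has_derivative g' x) (at x within S)"
    and inj: "inj_on g S"
    and det: "continuous_on S (\<lambda>x. det (matrix (g' x)))"
  shows "measure lebesgue (g ` S) = integral S (\<lambda>x. \<bar>det (matrix (g' x))\<bar>)"
proof -
  obtain k :: 'n where True by simp
  have cg: "continuous_on S g"
    using g' by (meson continuous_on_eq_continuous_within has_derivative_continuous)
  have cgS: "compact (g ` S)" using cg S by (rule compact_continuous_image)
  have "integral (g ` S) (\<lambda>_. 1 :: real^'n) $ k = measure lebesgue (g ` S)"
    using integrable_on_compact_continuous[OF cgS, of "\<lambda>_. 1 :: real^'n"]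
    by (subst integral_component_eq_cart[symmetric]) (auto simp: lmeasure_integral lmeasurable_compact cgS)
  moreover have "integral S (\<lambda>x. \<bar>det (matrix (g' x))\<bar> *\<^sub>R (1 :: real^'n)) $ k
      = integral S (\<lambda>x. \<bar>det (matrix (g' x))\<bar>)"
    by (subst integral_component_eq_cart[symmetric])
      (auto intro!: integrable_on_compact_continuous[OF S] continuous_intros det)
  ultimately show ?thesis
    using integral_change_of_variables_compact[OF S g' inj, of "\<lambda>_. 1 :: real^'n"] det by simp
qed

lemma centroid_compact:
  assumes "compact (S :: (real^'n) set)"
  shows "centroid S = (1 / measure lebesgue S) *\<^sub>R integral S (\<lambda>x. x)"
proof -
  have "set_integrable lebesgue S (\<lambda>x. x)"
    using borel_integrable_compact[OF assms continuous_on_id]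
    by (simp add: set_integrable_def integrable_completion)
  then show ?thesis
    unfolding centroid_def by (simp add: set_lebesgue_integral_eq_integral(2))
qed

lemma projected_volume_pos:
  fixes K :: "'a::euclidean_space set"
  assumes K: "compact K" "interior K \<noteq> {}" and a: "a \<in> slack_domain K q"
  shows "0 < projected_volume K q a"
proof -
  obtain y where y: "y \<in> interior K" using K(2) by blast
  obtain u v where uv: "cbox u v \<subseteq> interior K" "y \<in> box u v"
    using open_contains_cbox[OF open_interior y] by metis
  have sub: "cbox u v \<subseteq> K" using uv(1) interior_subset by blast
  let ?f = "\<lambda>x. 1 / slack q a x ^ (DIM('a) + 1)"
  have a': "a \<in> slack_domain (cbox u v) q" using a sub by (auto simp: slack_domain_def)
  have cont: "continuous_on (cbox u v) ?f"
    by (intro continuous_intros) (force dest: slack_domainD[OF a'])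
  have int: "?f integrable_on cbox u v" by (rule integrable_continuous[OF cont])
  have "integral (cbox u v) ?f \<noteq> 0"
  proof
    assume "integral (cbox u v) ?f = 0"
    then have "(?f has_integral 0) (cbox u v)" using integrable_integral[OF int] by simp
    then have "?f y = 0"
    proof (rule has_integral_0_cbox_imp_0[OF cont, rotated])
      show "0 \<le> ?f z" if "z \<in> box u v" for z
        using slack_domainD[OF a', of z] that box_subset_cbox[of u v] by force
      show "y \<in> cbox u v" using uv(2) box_subset_cbox[of u v] by blast
    qed (use uv(2) in blast)
    then show False
      using slack_domainD[OF a, of y] y interior_subset[of K] by auto
  qed
  moreover have "0 \<le> integral (cbox u v) ?f"
    by (intro integral_nonneg int) (use slack_domainD[OF a'] in force)
  moreover have "integral (cbox u v) ?f \<le> projected_volume K q a"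
    unfolding projected_volume_def
    by (intro integral_subset_le sub int integrands_integrable K(1) a)
      (use slack_domainD[OF a] in force)
  ultimately show ?thesis by linarith
qed

text \<open>
  Change of variables turns volume and first moment of the image into integrals over \<open>K\<close>. The
  factor \<open>\<bar>det A\<bar>\<close> cancels, so the centroid is computed as if \<open>A\<close> and \<open>b\<close> were applied to the centroid
  of the projected set.
\<close>

lemma centroid_affine_central_projection:
  fixes K :: "(real^'n) set" and A :: "real^'n^'n"
  assumes K: "compact K" "interior K \<noteq> {}" and a: "a \<in> slack_domain K q" and A: "invertible A"
  shows "centroid ((\<lambda>x. A *v central_projection q a x + b) ` K)
    = A *v (q + (1 / projected_volume K q a) *\<^sub>R projected_moment K q a) + b"
proof -
  let ?n = "CARD('n)" and ?s = "slack q a" and ?F = "projected_volume K q a" and ?G = "projected_moment K q a"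
  define g where "g x = A *v central_projection q a x + b" for x
  define D where "D x h = (1 / ?s x) *\<^sub>R (h + ((a \<bullet> h) / ?s x) *\<^sub>R (x - q))" for x h
  define g' where "g' x h = A *v D x h" for x h
  have pos: "0 < ?s x" if "x \<in> K" for x using a that by (rule slack_domainD)
  have g': "(g has_derivative g' x) (at x within K)" if "x \<in> K" for x
  proof -
    have "(central_projection q a has_derivative D x) (at x within K)"
      unfolding D_def using has_derivative_central_projection pos[OF that] by force
    from bounded_linear.has_derivative[OF matrix_vector_mul_bounded_linear this]
    show ?thesis
      unfolding g_def[abs_def] g'_def[abs_def] by (rule has_derivative_add_const)
  qed
  have det: "det (matrix (g' x)) = det A * (1 / ?s x ^ (?n + 1))" if "x \<in> K" for x
  proof -
    have "linear (D x)"
      unfolding D_def by (rule linearI) (simp_all add: algebra_simps inner_simps add_divide_distrib)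
    then have "matrix (g' x) = A ** matrix (D x)"
      using matrix_compose[of "D x" "(*v) A"] by (simp add: g'_def[abs_def] o_def)
    then show ?thesis
      using det_central_projection_derivative[of q a x] pos[OF that]
      by (simp add: det_mul D_def[abs_def])
  qed
  have absdet: "\<bar>det (matrix (g' x))\<bar> = \<bar>det A\<bar> * (1 / ?s x ^ (?n + 1))" if "x \<in> K" for x
    using pos[OF that] by (simp add: det[OF that] abs_mult)
  have detA: "\<bar>det A\<bar> \<noteq> 0" using A by (simp add: invertible_det_nz)
  have "continuous_on K (\<lambda>x. det A * (1 / ?s x ^ (?n + 1)))"
    by (intro continuous_intros) (use pos in force)
  then have cdet: "continuous_on K (\<lambda>x. det (matrix (g' x)))"
    by (rule continuous_on_eq) (simp add: det)
  have inj: "inj_on g K"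
  proof (rule inj_onI)
    fix x y assume xy: "x \<in> K" "y \<in> K" "g x = g y"
    have "inj ((*v) A)" using A by (metis invertible_left_inverse matrix_left_invertible_injective)
    then have "central_projection q a x = central_projection q a y"
      using xy(3) by (simp add: g_def inj_eq)
    then show "x = y" using inj_on_central_projection[of q a] xy pos by (auto dest: inj_onD)
  qed
  have cg: "continuous_on K g"
    using g' by (meson continuous_on_eq_continuous_within has_derivative_continuous)
  have cgK: "compact (g ` K)" using cg K(1) by (rule compact_continuous_image)
  have F: "(\<lambda>x. 1 / ?s x ^ (?n + 1)) integrable_on K"
    and G: "(\<lambda>x. (1 / ?s x ^ (?n + 2)) *\<^sub>R (x - q)) integrable_on K"
    by (rule integrands_integrable[OF K(1) a])+
  have vol: "measure lebesgue (g ` K) = \<bar>det A\<bar> * ?F"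
  proof -
    have "measure lebesgue (g ` K) = integral K (\<lambda>x. \<bar>det (matrix (g' x))\<bar>)"
      by (rule lmeasure_compact_image[OF K(1) g' inj cdet])
    also have "\<dots> = integral K (\<lambda>x. \<bar>det A\<bar> * (1 / ?s x ^ (?n + 1)))"
      by (rule integral_cong) (simp add: absdet)
    finally show ?thesis by (simp only: integral_mult_right projected_volume_def DIM_cart DIM_real mult_1_right)
  qed
  have mom: "integral (g ` K) (\<lambda>y. y) = \<bar>det A\<bar> *\<^sub>R (?F *\<^sub>R (A *v q + b) + A *v ?G)"
  proof -
    let ?AG = "\<lambda>x. A *v ((1 / ?s x ^ (?n + 2)) *\<^sub>R (x - q))"
    have AG: "?AG integrable_on K" "integral K ?AG = A *v ?G"
      using integrable_linear[OF G matrix_vector_mul_bounded_linear[of A]]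
        integral_linear[OF G matrix_vector_mul_bounded_linear[of A]]
      by (simp_all add: o_def projected_moment_def)
    have Fc: "(\<lambda>x. (1 / ?s x ^ (?n + 1)) *\<^sub>R (A *v q + b)) integrable_on K"
        "integral K (\<lambda>x. (1 / ?s x ^ (?n + 1)) *\<^sub>R (A *v q + b)) = ?F *\<^sub>R (A *v q + b)"
      using integrable_linear[OF F bounded_linear_scaleR_left[of "A *v q + b"]]
        integral_linear[OF F bounded_linear_scaleR_left[of "A *v q + b"]]
      by (simp_all add: o_def projected_volume_def)
    have "integral (g ` K) (\<lambda>y. y) = integral K (\<lambda>x. \<bar>det (matrix (g' x))\<bar> *\<^sub>R g x)"
      by (rule integral_change_of_variables_compact[OF K(1) g' inj continuous_on_id cdet])
    also have "\<dots> = integral K (\<lambda>x. \<bar>det A\<bar> *\<^sub>R ((1 / ?s x ^ (?n + 1)) *\<^sub>R (A *v q + b) + ?AG x))"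
    proof (rule integral_cong)
      fix x assume x: "x \<in> K"
      have "(1 / ?s x ^ (?n + 1)) *\<^sub>R g x = (1 / ?s x ^ (?n + 1)) *\<^sub>R (A *v q + b) + ?AG x"
        using pos[OF x]
        by (simp add: g_def central_projection_def matrix_vector_right_distrib matrix_vector_mult_scaleR
            scaleR_right_distrib)
      then show "\<bar>det (matrix (g' x))\<bar> *\<^sub>R g x
          = \<bar>det A\<bar> *\<^sub>R ((1 / ?s x ^ (?n + 1)) *\<^sub>R (A *v q + b) + ?AG x)"
        unfolding absdet[OF x] scaleR_scaleR[symmetric] by simp
    qed
    also have "\<dots> = \<bar>det A\<bar> *\<^sub>R (?F *\<^sub>R (A *v q + b) + A *v ?G)"
      by (simp only: integral_cmul integral_add[OF Fc(1) AG(1)] Fc(2) AG(2))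
    finally show ?thesis .
  qed
  have "0 < ?F" by (rule projected_volume_pos[OF K a])
  then have "centroid (g ` K) = (A *v q + b) + (1 / ?F) *\<^sub>R (A *v ?G)"
    unfolding centroid_compact[OF cgK] vol mom using detA
    by (simp add: scaleR_right_distrib)
  then show ?thesis
    by (simp add: g_def matrix_vector_right_distrib matrix_vector_mult_scaleR)
qed

section \<open>Projective transformations and their linear lifts\<close>

lemma homog_coords_nonzero: "homog_coords p \<noteq> 0"
  using Quotient3_rel_rep[OF Quotient3_proj_space, of p p] by (simp add: homog_rel_def)

lemma proj_point_homog_coords [simp]: "proj_point (homog_coords p) = p"
  by (rule Quotient3_abs_rep[OF Quotient3_proj_space])

lemma linear_inj_nonzero: "linear F \<Longrightarrow> inj F \<Longrightarrow> v \<noteq> 0 \<Longrightarrow> F v \<noteq> 0"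
  by (metis linear_injective_0)

text \<open>
  Applying \<open>F\<close> to the chosen homogeneous coordinates of a point is independent of that choice up to a
  scalar.
\<close>

lemma exists_induced_transformation:
  fixes F :: "real \<times> (real^'n) \<Rightarrow> real \<times> (real^'n)"
  assumes F: "linear F" "inj F"
  obtains \<phi> where "\<And>v. v \<noteq> 0 \<Longrightarrow> \<phi> (proj_point v) = proj_point (F v)"
proof
  fix v :: "real \<times> (real^'n)" assume v: "v \<noteq> 0"
  let ?w = "homog_coords (proj_point v)"
  have w: "?w \<noteq> 0" by (rule homog_coords_nonzero)
  have "proj_point v = proj_point ?w" by simp
  then obtain c where c: "c \<noteq> 0" "?w = c *\<^sub>R v"
    using v w proj_point_eq_iff by metis
  then have "F ?w = c *\<^sub>R F v" using F(1) by (simp add: linear_cmul)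
  then have "proj_point (F v) = proj_point (F ?w)"
    using proj_point_eq_iff[of "F v" "F ?w"] linear_inj_nonzero[OF F] v w c(1) by metis
  then show "(\<lambda>p. proj_point (F (homog_coords p))) (proj_point v) = proj_point (F v)" by simp
qed

text \<open>
  The linear map on homogeneous coordinates behind \<open>central_projection q a\<close>: with \<open>z = x - x\<^sub>0 q\<close>, the new
  zeroth coordinate is \<open>s = x\<^sub>0 - a \<bullet> z\<close>, and \<open>z\<close> is kept relative to the fixed point \<open>q\<close>.
\<close>

definition central_lift :: "'a::euclidean_space \<Rightarrow> 'a \<Rightarrow> real \<times> 'a \<Rightarrow> real \<times> 'a" where
  "central_lift q a v = (let z = snd v - fst v *\<^sub>R q; s = fst v - a \<bullet> z in (s, z + s *\<^sub>R q))"

definition central_unlift :: "'a::euclidean_space \<Rightarrow> 'a \<Rightarrow> real \<times> 'a \<Rightarrow> real \<times> 'a" where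
  "central_unlift q a v = (let z = snd v - fst v *\<^sub>R q; s = fst v + a \<bullet> z in (s, z + s *\<^sub>R q))"

definition affine_lift :: "real^'n^'n \<Rightarrow> real^'n \<Rightarrow> real \<times> (real^'n) \<Rightarrow> real \<times> (real^'n)" where
  "affine_lift A b v = (fst v, A *v snd v + fst v *\<^sub>R b)"

lemma central_unlift_lift [simp]: "central_unlift q a (central_lift q a v) = v"
  and central_lift_unlift [simp]: "central_lift q a (central_unlift q a v) = v"
  by (simp_all add: central_lift_def central_unlift_def Let_def)

lemma linear_central_lift: "linear (central_lift q a)"
  by (rule linearI) (simp_all add: central_lift_def Let_def algebra_simps inner_simps)

lemma linear_central_unlift: "linear (central_unlift q a)"
  by (rule linearI) (simp_all add: central_unlift_def Let_def algebra_simps inner_simps)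

lemma bij_central_lift: "bij (central_lift q a)"
  by (rule o_bij[where g = "central_unlift q a"]) (simp_all add: fun_eq_iff)

lemma linear_affine_lift: "linear (affine_lift A b)"
  by (rule linearI)
    (simp_all add: affine_lift_def algebra_simps matrix_vector_right_distrib matrix_vector_mult_scaleR)

lemma central_lift_chart:
  "slack q a x \<noteq> 0 \<Longrightarrow> central_lift q a (1, x) = slack q a x *\<^sub>R (1, central_projection q a x)"
  by (simp add: central_lift_def central_projection_def slack_def Let_def algebra_simps)

lemma proj_point_scaleR: "c \<noteq> 0 \<Longrightarrow> v \<noteq> 0 \<Longrightarrow> proj_point (c *\<^sub>R v) = proj_point v"
  by (subst proj_point_eq_iff) (auto intro!: exI[of _ "inverse c"])

lemma proj_point_affine_central_lift:
  assumes "slack q a x \<noteq> 0"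
  shows "proj_point (affine_lift A b (central_lift q a (1, x)))
    = affine_chart (A *v central_projection q a x + b)"
proof -
  have "affine_lift A b (central_lift q a (1, x))
      = slack q a x *\<^sub>R (1, A *v central_projection q a x + b)"
    unfolding central_lift_chart[OF assms] linear_cmul[OF linear_affine_lift]
    by (simp add: affine_lift_def)
  then show ?thesis
    using assms by (simp add: affine_chart_def proj_point_scaleR zero_prod_def del: scaleR_Pair)
qed

text \<open>
  Admissibility in terms of the lift: its zeroth coordinate is a linear form without zeros on
  \<open>conv K\<close>.
\<close>

lemma admissible_first_coordinate_nonzero:
  assumes G: "linear G" "inj G" "\<And>v. v \<noteq> 0 \<Longrightarrow> \<psi> (proj_point v) = proj_point (G v)"
    and adm: "admissible \<psi> K" and x: "x \<in> convex hull K"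
  shows "fst (G (1, x)) \<noteq> 0"
proof -
  have ne: "(1 :: real, x) \<noteq> 0" by (simp add: zero_prod_def)
  have "\<psi> (affine_chart x) \<in> range affine_chart"
    using adm x by (auto simp: admissible_def)
  then obtain y where "proj_point (G (1, x)) = proj_point (1, y)"
    using G(3)[OF ne] by (auto simp: affine_chart_def)
  then obtain c where "c \<noteq> 0" "(1, y) = c *\<^sub>R G (1, x)"
    using proj_point_eq_iff[of "G (1, x)" "(1, y)"] linear_inj_nonzero[OF G(1,2) ne]
    by (auto simp: zero_prod_def)
  then have "1 = c * fst (G (1, x))" by (metis fst_conv fst_scaleR real_scaleR_def)
  then show ?thesis by auto
qed

text \<open>
  The zeroth coordinate of a lift \<open>G\<close> of \<open>\<psi>\<close>, divided by its value at \<open>q\<close>, is \<open>slack q a\<close> for some \<open>a\<close>;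
  it is positive on \<open>K\<close> because it is \<open>1\<close> at \<open>q\<close> and has no zero on a segment from \<open>q\<close> to a point of \<open>K\<close>.
  Then \<open>G\<close> composed with the inverse of \<open>central_lift q a\<close> preserves the zeroth coordinate up to a scalar,
  which means that it is affine.
\<close>

lemma projective_normal_form:
  fixes \<psi> :: "'n::finite proj_space \<Rightarrow> 'n proj_space"
  assumes \<psi>: "projective_transformation \<psi>" "admissible \<psi> K" and q: "q \<in> convex hull K"
  obtains a A b where "a \<in> slack_domain K q" "invertible A"
    "\<And>v. v \<noteq> 0 \<Longrightarrow> \<psi> (proj_point v) = proj_point (affine_lift A b (central_lift q a v))"
proof -
  obtain G where G: "linear G" "bij G" "\<And>v. v \<noteq> 0 \<Longrightarrow> \<psi> (proj_point v) = proj_point (G v)"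
    using \<psi>(1) by (auto simp: projective_transformation_def)
  have injG: "inj G" using G(2) by (rule bij_is_inj)
  have nz: "fst (G (1, x)) \<noteq> 0" if "x \<in> convex hull K" for x
    by (rule admissible_first_coordinate_nonzero[OF G(1) injG G(3) \<psi>(2) that])
  define \<kappa> where "\<kappa> = fst (G (1, q))"
  have \<kappa>: "\<kappa> \<noteq> 0" unfolding \<kappa>_def by (rule nz[OF q])
  have lin0: "linear (\<lambda>y. (0 :: real, y :: real^'n))"
    by (rule linearI) simp_all
  have linL: "linear (\<lambda>y. fst (G (0, y)))"
    using linear_compose[OF linear_compose[OF lin0 G(1)] bounded_linear.linear[OF bounded_linear_fst]]
    by (simp add: o_def)
  define w where "w = adjoint (\<lambda>y. fst (G (0, y))) 1"
  have w: "fst (G (0, y)) = w \<bullet> y" for y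
    using adjoint_works[OF linL, of y 1] by (simp add: w_def inner_commute)
  define a where "a = - (1 / \<kappa>) *\<^sub>R w"
  have fstG: "fst (G (t, x)) = \<kappa> * fst (central_lift q a (t, x))" for t x
  proof -
    have "(t, x) = t *\<^sub>R (1, q) + (0, x - t *\<^sub>R q)" by simp
    then have "fst (G (t, x)) = fst (t *\<^sub>R G (1, q) + G (0, x - t *\<^sub>R q))"
      using G(1) by (simp only: linear_add linear_cmul)
    then have "fst (G (t, x)) = t * \<kappa> + w \<bullet> (x - t *\<^sub>R q)"
      by (simp add: w \<kappa>_def)
    then show ?thesis using \<kappa> by (simp add: central_lift_def Let_def a_def field_simps)
  qed
  have a: "a \<in> slack_domain K q"
    unfolding slack_domain_def
  proof (intro CollectI ballI, rule ccontr)
    fix x assume x: "x \<in> K" and "\<not> 0 < slack q a x"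
    then have ge: "1 \<le> a \<bullet> (x - q)" by (simp add: slack_def)
    \<comment> \<open>The point at parameter \<open>\<tau>\<close> on the segment from \<open>q\<close> to \<open>x\<close> is where the zeroth coordinate would vanish.\<close>
    define \<tau> where "\<tau> = 1 / (a \<bullet> (x - q))"
    have \<tau>: "0 < \<tau>" "\<tau> \<le> 1" "\<tau> * (a \<bullet> (x - q)) = 1" using ge by (auto simp: \<tau>_def)
    have "\<tau> *\<^sub>R x + (1 - \<tau>) *\<^sub>R q \<in> convex hull K"
      using q x \<tau> by (intro convexD[OF convex_convex_hull]) (auto intro: hull_inc)
    from nz[OF this] have "fst (central_lift q a (1, \<tau> *\<^sub>R x + (1 - \<tau>) *\<^sub>R q)) \<noteq> 0"
      unfolding fstG by auto
    moreover have "fst (central_lift q a (1, \<tau> *\<^sub>R x + (1 - \<tau>) *\<^sub>R q)) = 1 - \<tau> * (a \<bullet> (x - q))"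
      by (simp add: central_lift_def Let_def algebra_simps inner_simps)
    ultimately show False using \<tau>(3) by simp
  qed
  define H where "H v = (1 / \<kappa>) *\<^sub>R G (central_unlift q a v)" for v
  have linH: "linear H"
    unfolding H_def using linear_compose[OF linear_central_unlift G(1)]
    by (intro linear_compose_scale_right) (simp add: o_def)
  have injH: "inj H"
  proof (rule injI)
    fix v v' assume "H v = H v'"
    then have "central_unlift q a v = central_unlift q a v'"
      using \<kappa> by (simp add: H_def inj_eq[OF injG])
    then show "v = v'" by (metis central_lift_unlift)
  qed
  have fstH: "fst (H v) = fst v" for v
    using fstG[of "fst (central_unlift q a v)" "snd (central_unlift q a v)"] \<kappa>
    by (simp add: H_def)
  define A where "A = matrix (\<lambda>y. snd (H (0, y)))"
  define b where "b = snd (H (1, 0))"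
  have "linear (\<lambda>y. snd (H (0, y)))"
    using linear_compose[OF linear_compose[OF lin0 linH] bounded_linear.linear[OF bounded_linear_snd]]
    by (simp add: o_def)
  then have A: "A *v y = snd (H (0, y))" for y
    by (simp add: A_def matrix_works)
  have H: "H v = affine_lift A b v" for v
  proof -
    have "H v = H ((0, snd v) + fst v *\<^sub>R (1, 0))" by (simp add: prod_eq_iff)
    also have "\<dots> = H (0, snd v) + fst v *\<^sub>R H (1, 0)"
      by (simp only: linear_add[OF linH] linear_cmul[OF linH])
    finally have "snd (H v) = snd (H (0, snd v) + fst v *\<^sub>R H (1, 0))" by simp
    then show ?thesis by (simp add: prod_eq_iff affine_lift_def fstH A b_def)
  qed
  have "y = 0" if "A *v y = 0" for y
  proof -
    have "H (0, y) = 0" using that by (simp add: H affine_lift_def zero_prod_def)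
    then show ?thesis using linear_inj_nonzero[OF linH injH, of "(0, y)"] by (auto simp: zero_prod_def)
  qed
  then have invA: "invertible A"
    using matrix_left_invertible_ker[of A] by (simp add: invertible_left_inverse)
  have "\<psi> (proj_point v) = proj_point (affine_lift A b (central_lift q a v))" if v: "v \<noteq> 0" for v
  proof -
    have "affine_lift A b (central_lift q a v) = (1 / \<kappa>) *\<^sub>R G v"
      by (simp add: H[symmetric] H_def)
    then show ?thesis
      using \<kappa> v linear_inj_nonzero[OF G(1) injG v] by (simp add: G(3) proj_point_scaleR)
  qed
  with a invA show ?thesis by (rule that)
qed

lemma centering_iff_projected_moment_eq_0:
  fixes K :: "(real^'n) set" and \<psi> :: "'n proj_space \<Rightarrow> 'n proj_space"
  assumes K: "compact K" "interior K \<noteq> {}" and a: "a \<in> slack_domain K q" and A: "invertible A"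
    and \<psi>: "\<And>v. v \<noteq> 0 \<Longrightarrow> \<psi> (proj_point v) = proj_point (affine_lift A b (central_lift q a v))"
  shows "affine_chart (centroid (proj_image \<psi> K)) = \<psi> (affine_chart q)
    \<longleftrightarrow> projected_moment K q a = 0"
proof -
  have chart: "\<psi> (affine_chart x) = affine_chart (A *v central_projection q a x + b)"
    if "slack q a x \<noteq> 0" for x
    using proj_point_affine_central_lift[OF that, of A b] \<psi>[of "(1, x)"]
    by (simp add: affine_chart_def zero_prod_def)
  have "\<psi> ` affine_chart ` K = affine_chart ` (\<lambda>x. A *v central_projection q a x + b) ` K"
    unfolding image_image
    by (rule image_cong[OF refl], rule chart) (use slack_domainD[OF a] in force)
  then have img: "proj_image \<psi> K = (\<lambda>x. A *v central_projection q a x + b) ` K"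
    by (simp add: proj_image_def inj_vimage_image_eq inj_affine_chart)
  have q: "\<psi> (affine_chart q) = affine_chart (A *v q + b)"
    using chart[of q] by (simp add: slack_def)
  have inj: "inj ((*v) A)" using A by (metis invertible_left_inverse matrix_left_invertible_injective)
  show ?thesis
    unfolding q img centroid_affine_central_projection[OF K a A] inj_eq[OF inj_affine_chart]
    using projected_volume_pos[OF K a] inj_eq[OF inj] by auto
qed

text \<open>
  The common factor \<open>central_lift q a\<close> cancels in \<open>\<phi> \<circ> inv \<psi>\<close>, leaving the inverse of \<open>affine_lift A b\<close>.
\<close>

lemma affine_transformation_same_slack:
  fixes \<phi> \<psi> :: "'n::finite proj_space \<Rightarrow> 'n proj_space"
  assumes \<phi>: "\<And>v. v \<noteq> 0 \<Longrightarrow> \<phi> (proj_point v) = proj_point (central_lift q a v)"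
    and \<psi>: "\<And>v. v \<noteq> 0 \<Longrightarrow> \<psi> (proj_point v) = proj_point (affine_lift A b (central_lift q a v))"
    and A: "invertible A"
  shows "affine_transformation (\<phi> \<circ> inv \<psi>)"
proof -
  obtain B where AB: "A ** B = mat 1" "B ** A = mat 1" using A by (auto simp: invertible_def)
  have invB: "invertible B" using AB by (auto simp: invertible_def)
  define c where "c = - (B *v b)"
  have inv1: "affine_lift B c (affine_lift A b v) = v" and inv2: "affine_lift A b (affine_lift B c v) = v" for v
    by (simp_all add: affine_lift_def c_def matrix_vector_right_distrib matrix_vector_mult_scaleR
        matrix_vector_mul_assoc AB linear_neg[OF matrix_vector_mul_linear] matrix_vector_mult_diff_distrib prod_eq_iff)
  have bijA: "bij (affine_lift A b)" and bijB: "bij (affine_lift B c)"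
    by (rule o_bij[where g = "affine_lift B c"] o_bij[where g = "affine_lift A b"];
        simp add: fun_eq_iff inv1 inv2)+
  let ?G = "\<lambda>v. affine_lift A b (central_lift q a v)"
  have linG: "linear ?G"
    using linear_compose[OF linear_central_lift linear_affine_lift] by (simp add: o_def)
  have injG: "inj ?G"
    using inj_compose[OF bij_is_inj[OF bijA] bij_is_inj[OF bij_central_lift[of q a]]] by (simp add: o_def)
  have inj\<psi>: "inj \<psi>"
  proof (rule injI)
    fix p p' assume "\<psi> p = \<psi> p'"
    let ?v = "homog_coords p" and ?v' = "homog_coords p'"
    have nz: "?v \<noteq> 0" "?v' \<noteq> 0" by (rule homog_coords_nonzero)+
    have "proj_point (?G ?v) = proj_point (?G ?v')"
      using \<psi>[OF nz(1)] \<psi>[OF nz(2)] \<open>\<psi> p = \<psi> p'\<close> by simp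
    then obtain d where d: "d \<noteq> 0" "?G ?v' = d *\<^sub>R ?G ?v"
      using proj_point_eq_iff linear_inj_nonzero[OF linG injG] nz by metis
    then have "?G ?v' = ?G (d *\<^sub>R ?v)" using linear_cmul[OF linG] by simp
    then have "?v' = d *\<^sub>R ?v" using injD[OF injG] by blast
    then have "proj_point ?v' = proj_point ?v" using d(1) nz(1) by (simp add: proj_point_scaleR)
    then show "p = p'" by simp
  qed
  have comp: "(\<phi> \<circ> inv \<psi>) (proj_point v) = proj_point (affine_lift B c v)" if v: "v \<noteq> 0" for v
  proof -
    define u where "u = central_unlift q a (affine_lift B c v)"
    have Gu: "?G u = v" by (simp add: u_def inv2)
    then have u: "u \<noteq> 0" using v linear_0[OF linG] by auto
    have "inv \<psi> (proj_point v) = proj_point u"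
      using \<psi>[OF u] inj\<psi> by (metis Gu inv_f_f)
    then show ?thesis using \<phi>[OF u] by (simp add: u_def)
  qed
  show ?thesis
    unfolding affine_transformation_def projective_transformation_def
  proof (intro conjI exI allI impI)
    show "linear (affine_lift B c)" by (rule linear_affine_lift)
    show "bij (affine_lift B c)" by (rule bijB)
    show "invertible B" by (rule invB)
    show "(\<phi> \<circ> inv \<psi>) (affine_chart x) = affine_chart (B *v x + c)" for x
      using comp[of "(1, x)"] by (simp add: affine_chart_def affine_lift_def zero_prod_def)
  qed (rule comp)
qed

section \<open>Cusp-free sets and the centering transformation\<close>

text \<open>
  A boundary vector \<open>a\<close> of the slack domain has a point \<open>x\<close> of \<open>K\<close> with slack \<open>0\<close>, and the hyperplane of zero slack supports \<open>conv K\<close>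
  at \<open>x\<close>. So \<open>x\<close> lies on the frontier of \<open>conv K\<close>, and the simplex that cusp-freeness provides there
  is a convex body of positive volume on which the blow-up takes place.
\<close>

lemma projected_volume_blowup_cusp_free:
  fixes K :: "(real^'n) set"
  assumes K: "compact K" "cusp_free K" and q: "q \<in> interior (convex hull K)"
    and a: "a \<notin> slack_domain K q" "\<And>x. x \<in> K \<Longrightarrow> 0 \<le> slack q a x"
  shows "\<exists>e>0. \<forall>b\<in>slack_domain K q. dist b a < e \<longrightarrow> M < projected_volume K q b"
proof -
  obtain x where x: "x \<in> K" "slack q a x = 0"
    using a by (force simp: slack_domain_def)
  have a0: "a \<noteq> 0" using x(2) by (auto simp: slack_def)
  have "x \<notin> interior (convex hull K)"
  proof
    assume "x \<in> interior (convex hull K)"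
    then obtain r where r: "0 < r" "cball x r \<subseteq> convex hull K"
      by (auto simp: mem_interior_cball)
    have "x + (r / norm a) *\<^sub>R a \<in> convex hull K"
      using r a0 by (intro subsetD[OF r(2)]) (simp add: dist_norm)
    then have "0 \<le> slack q a (x + (r / norm a) *\<^sub>R a)"
      by (rule slack_nonneg_convex_hull[rotated]) (rule a(2))
    also have "slack q a (x + (r / norm a) *\<^sub>R a) = slack q a x - r * norm a"
      using a0 by (simp add: slack_def inner_simps dot_square_norm power2_eq_square)
    finally show False using x(2) r(1) a0 by (simp add: mult_le_0_iff)
  qed
  then have "x \<in> K \<inter> frontier (convex hull K)"
    using x(1) closure_subset[of "convex hull K"] hull_inc[of x K convex] by (auto simp: frontier_def)
  then obtain S where S: "int CARD('n) simplex S" "S \<subseteq> K" "x extreme_point_of S"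
    using K(2) unfolding cusp_free_def by blast
  have "convex S" "compact S" using S(1) by (auto intro: convex_simplex compact_simplex)
  moreover have "0 < measure lebesgue S"
  proof -
    have "aff_dim S = int (DIM(real^'n))" using aff_dim_simplex[OF S(1)] by simp
    then have "interior S \<noteq> {}"
      using \<open>convex S\<close> aff_dim_nonempty_interior interior_rel_interior_gen[of S] rel_interior_eq_empty[of S]
      by (metis aff_dim_empty of_nat_0_le_iff neg_equal_0_iff_equal add.inverse_inverse zero_neq_neg_one neg_0_le_iff_le not_one_le_zero)
    then have "\<not> negligible S"
      using open_not_negligible[of "interior S"] negligible_subset interior_subset by blast
    then show ?thesis
      using \<open>compact S\<close> by (metis lmeasurable_compact measure_nonneg negligible_iff_measure less_eq_real_def)
  qed
  moreover have "x \<in> S" using S(3) by (simp add: extreme_point_of_def)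
  ultimately show ?thesis
    using projected_volume_blowup[OF K(1) S(2)] x(2) by blast
qed

theorem theorem2:
  fixes K :: "(real^'n) set" and q :: "real^'n"
  assumes "compact K"
    and "K = closure (interior K)"
    and "cusp_free K"
    and "q \<in> interior (convex hull K)"
  shows "\<exists>\<phi>. projective_transformation \<phi> \<and> admissible \<phi> K \<and>
           affine_chart (centroid (proj_image \<phi> K)) = \<phi> (affine_chart q) \<and>
           (\<forall>\<psi>. projective_transformation \<psi> \<and> admissible \<psi> K \<and>
                  affine_chart (centroid (proj_image \<psi> K)) = \<psi> (affine_chart q)
                \<longrightarrow> affine_transformation (\<phi> \<circ> inv \<psi>))"
proof -
  have qK: "q \<in> convex hull K" using assms(4) interior_subset by blast
  have intK: "interior K \<noteq> {}"
    using qK assms(2) by (metis closure_empty convex_hull_empty empty_iff)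
  obtain a where a: "a \<in> slack_domain K q" "projected_moment K q a = 0"
    using exists_projected_moment_eq_0[OF assms(1,4) projected_volume_blowup_cusp_free[OF assms(1,3,4)]] by blast
  have inv1: "invertible (mat 1 :: real^'n^'n)"
    by (auto simp: invertible_def)
  have id: "affine_lift (mat 1) 0 v = v" for v :: "real \<times> (real^'n)"
    by (simp add: affine_lift_def)
  obtain \<phi> where \<phi>: "\<And>v. v \<noteq> 0 \<Longrightarrow> \<phi> (proj_point v) = proj_point (central_lift q a v)"
    using exists_induced_transformation[OF linear_central_lift bij_is_inj[OF bij_central_lift], of q a]
    by blast
  have "projective_transformation \<phi>"
    unfolding projective_transformation_def
    using \<phi> linear_central_lift bij_central_lift by blast
  moreover have "admissible \<phi> K"
    unfolding admissible_def
  proof (intro subsetI, elim imageE, simp)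
    fix x assume "x \<in> convex hull K"
    then have "slack q a x \<noteq> 0" using slack_pos_convex_hull[OF a(1)] by force
    then have "\<phi> (affine_chart x) = affine_chart (central_projection q a x)"
      using proj_point_affine_central_lift[of q a x "mat 1" 0] \<phi>[of "(1, x)"]
      by (simp add: id affine_chart_def zero_prod_def)
    then show "\<phi> (affine_chart x) \<in> range affine_chart" by simp
  qed
  moreover have "affine_chart (centroid (proj_image \<phi> K)) = \<phi> (affine_chart q)"
    using centering_iff_projected_moment_eq_0[OF assms(1) intK a(1) inv1, of \<phi> 0] a(2) \<phi>
    by (simp add: id)
  moreover have "affine_transformation (\<phi> \<circ> inv \<psi>)"
    if \<psi>: "projective_transformation \<psi>" "admissible \<psi> K"
      "affine_chart (centroid (proj_image \<psi> K)) = \<psi> (affine_chart q)" for \<psi>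
  proof -
    obtain a' A b where nf: "a' \<in> slack_domain K q" "invertible A"
        "\<And>v. v \<noteq> 0 \<Longrightarrow> \<psi> (proj_point v) = proj_point (affine_lift A b (central_lift q a' v))"
      using projective_normal_form[OF \<psi>(1,2) qK] by metis
    have "projected_moment K q a' = 0"
      using centering_iff_projected_moment_eq_0[OF assms(1) intK nf(1,2), of \<psi> b] nf(3) \<psi>(3) by blast
    then have "a' = a"
      using projected_moment_zero_unique[OF assms(1) intK] nf(1) a by blast
    then show ?thesis
      using affine_transformation_same_slack[of \<phi> q a \<psi> A b] \<phi> nf(2,3) by blast
  qed
  ultimately show ?thesis by blast
qed

end
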